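(* Let $1\le p<\infty$. Let $f\in L^p(\mathbb{R})$. With $u_s(t)=\frac{1-e^{-ist}}{it}$ ($u_s(0)=s$) and $\Psi_f(s)=\int_{-\infty}^\infty u_s(t)f(t)\,dt$, define the Fourier transform of $f$ as the distributional derivative $\hat f=\Psi_f'$. (a) The Fourier transform is a bounded linear isomorphism and isometry $L^p(\mathbb{R})\to\mathcal{A}_p(\mathbb{R})$, $\|\hat f\|_p''=\|f\|_p$. (b) Let $F^{(n-1)}$ be absolutely continuous such that $F^{(n)}\in L^p(\mathbb{R})$ (where $n\ge1$ is an integer). For each $0\le k\le n-2$ suppose $\lim_{|t|\to\infty}F^{(k)}(t)/t=0$. Then $\widehat{D^nF}=\Psi_{F^{(n)}}'$ where $$\Psi_{F^{(n)}}(s)=\int_{-\infty}^\infty\frac{n!}{it^{n+1}}\left[1-e^{-ist}\sum_{k=0}^n\frac{(ist)^k}{k!}\right]F(t)\,dt.$$ (c) $D^n\hat f=\Psi_f^{(n+1)}$. (d) Let $a\in\mathbb{R}$. Then $\widehat{\tau_af}=\Psi_{\tau_af}'$ where $\Psi_{\tau_af}(s)=(f\ast\tilde u_s)(-a)$. (e) Let $a\in\mathbb{R}$ and $F(t)=e^{iat}f(t)$. Then $\hat F=(\tau_a\Psi_f)'$. (f) $\hat{\tilde f}=\Psi_{\tilde f}'$ where $\Psi_{\tilde f}=-\tilde\Psi_f$ (with $\tilde\Psi_f(s)=\Psi_f(-s)$). (g) If $\hat f\in L^r(\mathbb{R})$ for some $1\le r<\infty$ then $\hat{\hat f}=\Psi_{\hat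 f}'$. (h) Let $g(x)=f(ax+b)$ for $a,b\in\mathbb{R}$ with $a\ne0$. Then $\hat g=\Psi_g'$ where $\Psi_g(s)=\operatorname{sgn}(a)\,\Psi_{\tau_{-b}f}(s/a)$.
   Context: $L^p(\mathbb{R})$ is the usual Lebesgue space on the real line with norm $\|\cdot\|_p$. For $f\in L^p(\mathbb{R})$, $\Psi_f$ is continuous and of at most polynomial growth, and $\hat f=\Psi_f'$ is the tempered distribution $\langle\hat f,\phi\rangle=-\int_{-\infty}^\infty\Psi_f(s)\phi'(s)\,ds$ for $\phi$ in the Schwartz space $\mathcal{S}(\mathbb{R})$; primes, superscripts $(n+1)$ and $D$ applied to distributions and to the functions $\Psi_f$ denote distributional derivatives. $\mathcal{A}_p(\mathbb{R})=\{\Psi_f'\mid f\in L^p(\mathbb{R})\}$ with norm $\|\Psi_f'\|_p''=\|f\|_p$. Translation: $\tau_af(x)=f(x-a)$. Reflection: $\tilde f(x)=f(-x)$, and $\tilde u_s(t)=u_s(-t)$. Convolution: $(f\ast g)(x)=\int_{-\infty}^\infty f(t)g(x-t)\,dt$. *)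

theory Defs
  imports "HOL-Analysis.Analysis"
begin

section \<open>Lebesgue spaces on the real line\<close>

text \<open>Elements of \<open>L\<^sup>p(\<real>)\<close> are represented by functions; two functions represent the same
  element iff they agree almost everywhere.\<close>

definition Lp :: "real \<Rightarrow> (real \<Rightarrow> complex) set" where
  "Lp p = {f. f \<in> borel_measurable lebesgue \<and> integrable lebesgue (\<lambda>x. norm (f x) powr p)}"

definition Lp_norm :: "real \<Rightarrow> (real \<Rightarrow> complex) \<Rightarrow> real" where
  "Lp_norm p f = (LINT x|lebesgue. norm (f x) powr p) powr (1 / p)"

definition translate :: "real \<Rightarrow> (real \<Rightarrow> complex) \<Rightarrow> real \<Rightarrow> complex" where
  "translate a f = (\<lambda>x. f (x - a))"

definition reflect :: "(real \<Rightarrow> complex) \<Rightarrow> real \<Rightarrow> complex" where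
  "reflect f = (\<lambda>x. f (- x))"

definition conv :: "(real \<Rightarrow> complex) \<Rightarrow> (real \<Rightarrow> complex) \<Rightarrow> real \<Rightarrow> complex" where
  "conv f g = (\<lambda>x. LINT t|lebesgue. f t * g (x - t))"


section \<open>Pointwise derivatives and absolute continuity\<close>

definition vderiv :: "(real \<Rightarrow> complex) \<Rightarrow> real \<Rightarrow> complex" where
  "vderiv f = (\<lambda>x. vector_derivative f (at x))"

text \<open>The usual epsilon-delta definition on every compact interval.\<close>

definition abs_cont :: "(real \<Rightarrow> complex) \<Rightarrow> bool" where
  "abs_cont f \<longleftrightarrow> (\<forall>a b. \<forall>\<epsilon>>0. \<exists>\<delta>>0. \<forall>(m::nat) (x::nat \<Rightarrow> real) (y::nat \<Rightarrow> real).
     (\<forall>i<m. a \<le> x i \<and> x i \<le> y i \<and> y i \<le> b) \<longrightarrow>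
     disjoint_family_on (\<lambda>i. {x i<..<y i}) {..<m} \<longrightarrow>
     (\<Sum>i<m. y i - x i) < \<delta> \<longrightarrow> (\<Sum>i<m. norm (f (y i) - f (x i))) < \<epsilon>)"


section \<open>Tempered distributions\<close>

definition Schwartz :: "(real \<Rightarrow> complex) set" where
  "Schwartz = {\<phi>. (\<forall>k x. (vderiv ^^ k) \<phi> differentiable (at x)) \<and>
     (\<forall>m k. \<exists>C. \<forall>x. \<bar>x\<bar> ^ m * norm ((vderiv ^^ k) \<phi> x) \<le> C)}"

text \<open>Functionals on the Schwartz space are represented as functions that are extensional on
  \<^const>\<open>Schwartz\<close>, so that equality of such functions is equality of functionals.\<close>

type_synonym functional = "(real \<Rightarrow> complex) \<Rightarrow> complex"

definition tempered :: "functional set" where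
  "tempered = {T \<in> extensional Schwartz.
     (\<forall>\<phi>\<in>Schwartz. \<forall>\<psi>\<in>Schwartz. \<forall>c d. T (\<lambda>x. c * \<phi> x + d * \<psi> x) = c * T \<phi> + d * T \<psi>) \<and>
     (\<exists>C N. \<forall>\<phi>\<in>Schwartz. norm (T \<phi>) \<le>
        C * (\<Sum>m\<le>N. \<Sum>k\<le>N. SUP x. \<bar>x\<bar> ^ m * norm ((vderiv ^^ k) \<phi> x)))}"

definition dist_add :: "functional \<Rightarrow> functional \<Rightarrow> functional" where
  "dist_add T S = (\<lambda>\<phi>\<in>Schwartz. T \<phi> + S \<phi>)"

definition dist_scale :: "complex \<Rightarrow> functional \<Rightarrow> functional" where
  "dist_scale c T = (\<lambda>\<phi>\<in>Schwartz. c * T \<phi>)"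

definition regular_dist :: "(real \<Rightarrow> complex) \<Rightarrow> functional" where
  "regular_dist g = (\<lambda>\<phi>\<in>Schwartz. LINT x|lebesgue. g x * \<phi> x)"

definition dist_deriv :: "functional \<Rightarrow> functional" where
  "dist_deriv T = (\<lambda>\<phi>\<in>Schwartz. - T (vderiv \<phi>))"


section \<open>The Fourier transform\<close>

definition u_fun :: "real \<Rightarrow> real \<Rightarrow> complex" where
  "u_fun s t = (if t = 0 then of_real s
            else (1 - exp (- (\<i> * of_real s * of_real t))) / (\<i> * of_real t))"

definition Psi :: "(real \<Rightarrow> complex) \<Rightarrow> real \<Rightarrow> complex" where
  "Psi f s = (LINT t|lebesgue. u_fun s t * f t)"

definition fourier :: "(real \<Rightarrow> complex) \<Rightarrow> functional" where
  "fourier f = dist_deriv (regular_dist (Psi f))"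

definition Ap :: "real \<Rightarrow> functional set" where
  "Ap p = fourier ` Lp p"

definition Ap_norm :: "real \<Rightarrow> functional \<Rightarrow> real" where
  "Ap_norm p T = (THE c. \<exists>f\<in>Lp p. fourier f = T \<and> c = Lp_norm p f)"

text \<open>The Fourier transform of a distribution that belongs to some \<open>L\<^sup>r(\<real>)\<close>, i.e. that is
  the regular distribution of an \<open>L\<^sup>r\<close> function.\<close>

definition fourier_dist :: "functional \<Rightarrow> functional" where
  "fourier_dist T = (THE U. \<exists>r\<ge>1. \<exists>h\<in>Lp r. T = regular_dist h \<and> U = fourier h)"

text \<open>For \<open>t \<noteq> 0\<close> this is \<open>(-1)\<^sup>n\<close> times the \<open>n\<close>-th derivative of \<open>u_fun s\<close> at \<open>t\<close>.\<close>

definition u_deriv_kernel :: "nat \<Rightarrow> real \<Rightarrow> real \<Rightarrow> complex" where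
  "u_deriv_kernel n s t = fact n / (\<i> * of_real t ^ (n + 1)) *
     (1 - exp (- (\<i> * of_real s * of_real t)) *
        (\<Sum>k=0..n. (\<i> * of_real s * of_real t) ^ k / fact k))"

end

theory Submission
  imports Defs "HOL-Probability.Probability" "HOL-Complex_Analysis.Complex_Analysis"
begin

text \<open>If \<open>f\<close> is in \<open>L\<^sup>p\<close> with \<open>p \<ge> 1\<close>, then \<open>f(t) / (1 + |t|)\<close> is integrable by Young's
  inequality. Since \<open>|u_fun s t| \<le> (2 + |s|) / (1 + |t|)\<close>, this weighted integrability is all that
  is needed for \<open>Psi f\<close> to exist and to grow at most linearly, for every \<open>p\<close> at once.

  Injectivity: by Fubini and \<open>d/ds u_fun s t = exp(-ist)\<close>, pairing the transform of \<open>f\<close> with a Schwartz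
  function \<open>\<phi>\<close> gives the integral of \<open>f\<close> against the classical Fourier transform of \<open>\<phi>\<close>. Modulated
  Gaussians have translated Gaussians as transforms, and a function that annihilates all of these
  vanishes almost everywhere.

  Part (b) is \<open>n\<close>-fold integration by parts on \<open>[a, b]\<close>. The first step uses the fundamental theorem of
  calculus for absolutely continuous functions. The boundary terms vanish as \<open>a\<close> and \<open>b\<close> tend to
  infinity since all derivatives of \<open>u_fun s\<close> are \<open>O(1/t)\<close> while \<open>F\<^sup>(\<^sup>k\<^sup>)(t) = o(t)\<close>; for
  \<open>k = n - 1\<close> this growth bound follows from \<open>F\<^sup>(\<^sup>n\<^sup>)\<close> being in \<open>L\<^sup>p\<close>.\<close>

section \<open>Functions with integrable \<open>f(t) / (1 + |t|)\<close>\<close>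

text \<open>The exponential pairs absolutely with L^1 functions only, whereas u_s is bounded and
  O(1/t); this is what lets one formula serve all p. The class below contains every L^r with r >= 1,
  so uniqueness proved for it compares functions of different exponents. The definite description in
  \<open>fourier_dist\<close> needs exactly that for (g), and the one in \<open>Ap_norm\<close> is
  justified in the same way.

  In (b) the integral over the line may converge only conditionally: for n = 1, F = 1 and s nonzero
  the integrand behaves like a constant times exp(-ist)/t, although F' = 0. Hence the conclusion
  uses the gauge integral, which covers improper integrals, and convergence is read off from the
  identity on [a, b] instead of a majorant. The explicit kernel takes the value 0 at t = 0 through
  division by zero; the computation therefore runs with a smooth extension and is transferred at the
  end, off a single point.\<close>

definition tame :: "(real \<Rightarrow> complex) \<Rightarrow> bool" where
  "tame f \<longleftrightarrow> f \<in> borel_measurable lebesgue \<and> integrable lebesgue (\<lambda>t. norm (f t) / (1 + \<bar>t\<bar>))"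

lemma measurable_ident_lebesgue: "(\<lambda>x::real. x) \<in> borel_measurable lebesgue"
  by (intro measurable_completion) measurable

lemma one_plus_abs_pos: "0 < 1 + \<bar>t::real\<bar>" by linarith

text \<open>The function \<open>x powr (-q)\<close> on x >= 1, shifted by 1 and also reflected,
  gives two tails whose sum dominates the even weight, since 1 + |t| is 1 + t or 1 - t.\<close>

lemma integrable_one_plus_abs_powr:
  fixes q :: real
  assumes "1 < q"
  shows "integrable lborel (\<lambda>t::real. (1 + \<bar>t\<bar>) powr (- q))"
proof -
  have 1: "((\<lambda>x::real. x powr (-q)) has_integral -(1 powr (-q + 1)) / (-q + 1)) {1..}"
    by (rule has_integral_powr_to_inf) (use assms in auto)
  have "(\<lambda>x::real. x powr (-q)) absolutely_integrable_on {1..}"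
    by (rule nonnegative_absolutely_integrable_1) (use 1 in \<open>auto simp: integrable_on_def\<close>)
  then have "integrable lebesgue (\<lambda>x::real. indicator {1..} x *\<^sub>R x powr (-q))"
    by (simp add: set_integrable_def)
  then have i: "integrable lborel (\<lambda>x::real. indicator {1..} x *\<^sub>R x powr (-q))"
    by (subst (asm) integrable_completion) auto
  have a: "integrable lborel (\<lambda>x::real. indicator {1..} (1 + 1 * x) *\<^sub>R (1 + 1 * x) powr (-q))"
    by (rule lborel_integrable_real_affine[OF i]) auto
  have b: "integrable lborel (\<lambda>x::real. indicator {1..} (1 + (-1) * x) *\<^sub>R (1 + (-1) * x) powr (-q))"
    by (rule lborel_integrable_real_affine[OF i]) auto
  have "integrable lborel (\<lambda>x::real. indicator {1..} (1 + 1 * x) *\<^sub>R (1 + 1 * x) powr (-q)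
      + indicator {1..} (1 + (-1) * x) *\<^sub>R (1 + (-1) * x) powr (-q))"
    using a b by (rule Bochner_Integration.integrable_add)
  then show ?thesis
    by (rule Bochner_Integration.integrable_bound)
       (auto intro!: AE_I2 simp: indicator_def)
qed

lemma Lp_imp_tame:
  assumes "1 \<le> p" "f \<in> Lp p"
  shows "tame f"
proof -
  note [measurable] = measurable_ident_lebesgue
  have [measurable]: "f \<in> borel_measurable lebesgue"
    and i: "integrable lebesgue (\<lambda>x. norm (f x) powr p)"
    using assms(2) by (auto simp: Lp_def)
  have "integrable lebesgue (\<lambda>t. norm (f t) / (1 + \<bar>t\<bar>))"
  proof (cases "p = 1")
    case True
    show ?thesis
      by (rule Bochner_Integration.integrable_bound[OF i]) (auto intro!: AE_I2 simp: True divide_le_eq mult_le_cancel_left1 add_pos_nonneg)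
  next
    case False
    with assms have p: "1 < p" by auto
    \<comment> \<open>The conjugate exponent: 1/p + 1/q = 1. It exceeds 1, so the weight to the
      power q is integrable.\<close>
    define q where "q = p / (p - 1)"
    have q: "1 < q" using p by (simp add: q_def field_simps)
    have "integrable lebesgue (\<lambda>t::real. (1 + \<bar>t\<bar>) powr (- q))"
      using integrable_one_plus_abs_powr[OF q] by (simp add: integrable_completion)
    with i have "integrable lebesgue (\<lambda>t. norm (f t) powr p + (1 + \<bar>t\<bar>) powr (- q))"
      by auto
    then show ?thesis
    proof (rule Bochner_Integration.integrable_bound)
      show "AE t in lebesgue. norm (norm (f t) / (1 + \<bar>t\<bar>)) \<le> norm (norm (f t) powr p + (1 + \<bar>t\<bar>) powr (- q))"
      proof (rule AE_I2)
        fix t :: real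
        define a b where "a = norm (f t)" and "b = 1 / (1 + \<bar>t\<bar>)"
        have b: "b > 0" and a: "a \<ge> 0" by (auto simp: a_def b_def add_pos_nonneg)
        have bq: "(1 + \<bar>t\<bar>) powr (- q) = b powr q"
          by (simp add: b_def powr_minus powr_divide field_simps)
        \<comment> \<open>Young's inequality with crude constants: if b <= a^(p-1) the product is at
          most a^p, otherwise a <= b^(1/(p-1)) and the product is at most b^q.\<close>
        have "a * b \<le> a powr p + b powr q"
        proof (cases "b \<le> a powr (p - 1)")
          case True
          then have "a * b \<le> a * a powr (p - 1)" using a by (intro mult_left_mono) auto
          also have "\<dots> = a powr p" 
          proof (cases "a = 0")
            case False
            then have "a powr 1 * a powr (p - 1) = a powr p" by (subst powr_add[symmetric]) auto
            then show ?thesis using a by simp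
          qed simp
          finally show ?thesis by (smt (verit) powr_ge_zero)
        next
          case False
          have "a = (a powr (p - 1)) powr (1 / (p - 1))"
            using p a by (simp add: powr_powr)
          also have "\<dots> \<le> b powr (1 / (p - 1))"
            using False p by (intro powr_mono2) auto
          finally have "a * b \<le> b powr (1 / (p - 1)) * b" using b by (intro mult_right_mono) auto
          also have "\<dots> = b powr (1 / (p - 1) + 1)" using b by (simp add: powr_add)
          also have "1 / (p - 1) + 1 = q" using p by (simp add: q_def field_simps)
          finally show ?thesis by (smt (verit) powr_ge_zero)
        qed
        then show "norm (norm (f t) / (1 + \<bar>t\<bar>)) \<le> norm (norm (f t) powr p + (1 + \<bar>t\<bar>) powr (- q))"
          unfolding bq by (simp add: a_def b_def)
      qed
    qed simp
  qed
  then show ?thesis by (simp add: tame_def)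
qed

section \<open>Closure of the Lebesgue spaces under sums, bounded multipliers and affine
  substitutions\<close>

lemma Lp_add:
  assumes "0 \<le> p" "g \<in> Lp p" "h \<in> Lp p"
  shows "(\<lambda>x. g x + h x) \<in> Lp p"
proof -
  have [measurable]: "g \<in> borel_measurable lebesgue" "h \<in> borel_measurable lebesgue"
    and i: "integrable lebesgue (\<lambda>x. norm (g x) powr p)" "integrable lebesgue (\<lambda>x. norm (h x) powr p)"
    using assms by (auto simp: Lp_def)
  have "integrable lebesgue (\<lambda>x. 2 powr p * (norm (g x) powr p + norm (h x) powr p))"
    using i by auto
  then have "integrable lebesgue (\<lambda>x. norm (g x + h x) powr p)"
  proof (rule Bochner_Integration.integrable_bound)
    show "AE x in lebesgue. norm (norm (g x + h x) powr p) \<le> norm (2 powr p * (norm (g x) powr p + norm (h x) powr p))"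
    proof (rule AE_I2)
      fix x
      \<comment> \<open>The factor 2^p comes from |g + h| <= 2 max(|g|, |h|); the p-th power of a
        maximum is at most the sum of the p-th powers.\<close>
      have "norm (g x + h x) powr p \<le> (2 * max (norm (g x)) (norm (h x))) powr p"
        using norm_triangle_ineq[of "g x" "h x"] assms(1) by (intro powr_mono2) auto
      also have "\<dots> = 2 powr p * max (norm (g x)) (norm (h x)) powr p"
        by (simp add: powr_mult)
      also have "max (norm (g x)) (norm (h x)) powr p \<le> norm (g x) powr p + norm (h x) powr p"
        by (auto simp: max_def)
      finally show "norm (norm (g x + h x) powr p) \<le> norm (2 powr p * (norm (g x) powr p + norm (h x) powr p))"
        by simp
    qed
  qed measurable
  then show ?thesis by (simp add: Lp_def)
qed

lemma Lp_bounded_mult: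
  assumes "f \<in> Lp p" "0 \<le> p" "m \<in> borel_measurable lebesgue" "\<And>x. norm (m x) \<le> C"
  shows "(\<lambda>x. m x * f x) \<in> Lp p"
proof -
  have [measurable]: "f \<in> borel_measurable lebesgue" "m \<in> borel_measurable lebesgue"
    and i: "integrable lebesgue (\<lambda>x. norm (f x) powr p)"
    using assms by (auto simp: Lp_def)
  have C: "0 \<le> C" using assms(4)[of 0] norm_ge_zero order_trans by blast
  have "integrable lebesgue (\<lambda>x. C powr p * norm (f x) powr p)" using i by auto
  then have "integrable lebesgue (\<lambda>x. norm (m x * f x) powr p)"
  proof (rule Bochner_Integration.integrable_bound)
    show "AE x in lebesgue. norm (norm (m x * f x) powr p) \<le> norm (C powr p * norm (f x) powr p)"
      using assms C by (intro AE_I2) (auto simp: norm_mult powr_mult abs_mult intro!: mult_right_mono powr_mono2)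
  qed measurable
  then show ?thesis by (simp add: Lp_def)
qed

lemma Lp_affine:
  assumes "f \<in> Lp p" "c \<noteq> 0"
  shows "(\<lambda>x. f (b + c * x)) \<in> Lp p"
proof -
  have [measurable]: "f \<in> borel_measurable lebesgue"
    and i: "integrable lebesgue (\<lambda>x. norm (f x) powr p)"
    using assms by (auto simp: Lp_def)
  have "(\<lambda>x. b + c * x) \<in> lebesgue \<rightarrow>\<^sub>M lebesgue"
    using lebesgue_affine_measurable[where c= "\<lambda>x::real. c"] assms by simp
  then have "(\<lambda>x. f (b + c * x)) \<in> borel_measurable lebesgue" by measurable
  moreover have "integrable lebesgue (\<lambda>x. norm (f (b + c * x)) powr p)"
    using i lebesgue_integrable_real_affine_iff[OF assms(2), of "\<lambda>x. norm (f x) powr p"] by simp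
  ultimately show ?thesis by (simp add: Lp_def)
qed

section \<open>Stability of the weighted class\<close>

lemma tame_measurable: "tame f \<Longrightarrow> f \<in> borel_measurable lebesgue"
  by (simp add: tame_def)

lemma tame_bound:
  assumes "tame g" "f \<in> borel_measurable lebesgue" "\<And>x. norm (f x) \<le> C * norm (g x)"
  shows "tame f"
proof -
  note [measurable] = measurable_ident_lebesgue
  have [measurable]: "f \<in> borel_measurable lebesgue" by fact
  have "integrable lebesgue (\<lambda>t. C * (norm (g t) / (1 + \<bar>t\<bar>)))"
    using assms(1) by (intro integrable_mult_right) (simp add: tame_def)
  then have "integrable lebesgue (\<lambda>t. norm (f t) / (1 + \<bar>t\<bar>))"
  proof (rule Bochner_Integration.integrable_bound)
    show "AE t in lebesgue. norm (norm (f t) / (1 + \<bar>t\<bar>)) \<le> norm (C * (norm (g t) / (1 + \<bar>t\<bar>)))"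
      using assms(3) by (intro AE_I2) (auto intro!: divide_right_mono order_trans[OF assms(3) abs_ge_self])
  qed measurable
  with assms(2) show ?thesis by (simp add: tame_def)
qed

lemma tame_cmult:
  assumes "tame f"
  shows "tame (\<lambda>x. c * f x)"
proof (rule tame_bound[OF assms])
  note [measurable] = assms[THEN tame_measurable]
  show "(\<lambda>x. c * f x) \<in> borel_measurable lebesgue" by measurable
  show "norm (c * f x) \<le> norm c * norm (f x)" for x by (simp add: norm_mult)
qed

lemma tame_add:
  assumes "tame f" "tame g"
  shows "tame (\<lambda>x. f x + g x)"
proof -
  note [measurable] = measurable_ident_lebesgue
  note [measurable] = assms[THEN tame_measurable]
  have "integrable lebesgue (\<lambda>t. norm (f t) / (1 + \<bar>t\<bar>) + norm (g t) / (1 + \<bar>t\<bar>))"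
    using assms by (auto simp: tame_def)
  then have "integrable lebesgue (\<lambda>t. norm (f t + g t) / (1 + \<bar>t\<bar>))"
  proof (rule Bochner_Integration.integrable_bound)
    show "AE t in lebesgue. norm (norm (f t + g t) / (1 + \<bar>t\<bar>)) \<le> norm (norm (f t) / (1 + \<bar>t\<bar>) + norm (g t) / (1 + \<bar>t\<bar>))"
      by (intro AE_I2) (auto simp flip: add_divide_distrib intro!: divide_right_mono norm_triangle_ineq intro: order_trans)
  qed measurable
  then show ?thesis by (simp add: tame_def)
qed

lemma tame_diff: "tame f \<Longrightarrow> tame g \<Longrightarrow> tame (\<lambda>x. f x - g x)"
  using tame_add[of f "\<lambda>x. (-1) * g x"] tame_cmult[of g "-1"] by simp

section \<open>The kernel\<close>

lemma norm_u_fun_le: "norm (u_fun s t) \<le> \<bar>s\<bar>"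
proof (cases "t = 0")
  case False
  \<comment> \<open>The Taylor estimate of order 0, |exp(ix) - 1| <= |x|, at x = -st.\<close>
  have "norm (iexp (-(s * t)) - (\<Sum>k\<le>0. (\<i> * of_real (-(s*t)))^k / fact k)) \<le> \<bar>-(s*t)\<bar>^(Suc 0) / fact (Suc 0)"
    by (rule iexp_approx1)
  then have "norm (1 - iexp (-(s * t))) \<le> \<bar>s\<bar> * \<bar>t\<bar>"
    by (simp add: norm_minus_commute abs_mult)
  then show ?thesis using False
    by (simp add: u_fun_def norm_divide norm_mult divide_le_eq mult_ac)
qed (simp add: u_fun_def)

lemma norm_u_fun_mult_le: "norm (u_fun s t) * \<bar>t\<bar> \<le> 2"
proof (cases "t = 0")
  case False
  have "norm (1 - exp (- (\<i> * of_real s * of_real t))) \<le> norm (1::complex) + norm (exp (- (\<i> * of_real s * of_real t)))"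
    by (rule norm_triangle_ineq4)
  also have "\<dots> = 2" by (simp add: norm_exp_eq_Re)
  finally show ?thesis using False
    by (simp add: u_fun_def norm_divide norm_mult)
qed simp

text \<open>The sum of two bounds: |s| for the kernel, good near t = 0, and 2 for the kernel times
  |t|, good at infinity.\<close>

lemma norm_u_fun_le_weight: "norm (u_fun s t) \<le> (2 + \<bar>s\<bar>) / (1 + \<bar>t\<bar>)"
  using norm_u_fun_le[of s t] norm_u_fun_mult_le[of s t] one_plus_abs_pos[of t]
  by (simp add: le_divide_eq algebra_simps)

text \<open>The homogeneity behind \<open>Psi_scale\<close>, and through it behind reflections and
  affine substitutions.\<close>

lemma u_fun_scale: "a \<noteq> 0 \<Longrightarrow> u_fun s (t / a) = of_real a * u_fun (s / a) t"
  by (auto simp: u_fun_def field_simps)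

text \<open>exp(iat)(1 - exp(-ist)) = (1 - exp(-i(s-a)t)) - (1 - exp(iat)). A modulation thus shifts
  s, and the subtracted term is free of s, so it adds only a constant to \<open>Psi\<close>.\<close>

lemma u_fun_mult_exp: "u_fun s t * exp (\<i> * of_real a * of_real t) = u_fun (s - a) t - u_fun (- a) t"
proof (cases "t = 0")
  case False
  have "exp (- (\<i> * of_real s * of_real t)) * exp (\<i> * of_real a * of_real t) = exp (- (\<i> * of_real (s - a) * of_real t))"
    by (simp add: exp_add[symmetric] algebra_simps)
  then show ?thesis using False
    by (simp add: u_fun_def diff_divide_distrib[symmetric] left_diff_distrib)
qed (simp add: u_fun_def)

lemma borel_measurable_u_fun [measurable (raw)]:
  assumes [measurable]: "f \<in> borel_measurable M" "g \<in> borel_measurable M"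
  shows "(\<lambda>x. u_fun (f x) (g x)) \<in> borel_measurable M"
  unfolding u_fun_def by measurable

lemma u_fun_has_vector_derivative:
  "((\<lambda>s. u_fun s t) has_vector_derivative exp (- (\<i> * of_real s * of_real t))) (at s)"
proof (cases "t = 0")
  case True
  then show ?thesis by (auto simp: u_fun_def[abs_def] intro!: derivative_eq_intros)
next
  case False
  have "((\<lambda>s. (1 - exp (- (\<i> * s * of_real t))) / (\<i> * of_real t)) has_field_derivative exp (- (\<i> * of_real s * of_real t))) (at (of_real s))"
    using False by (auto intro!: derivative_eq_intros)
  from has_vector_derivative_real_field[OF this] False show ?thesis
    by (simp add: u_fun_def[abs_def])
qed

lemma measurable_u_fun_lebesgue [measurable]: "u_fun s \<in> borel_measurable lebesgue"
  by (intro borel_measurable_u_fun measurable_ident_lebesgue) simp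

lemma norm_u_fun_mult_bound:
  "norm (u_fun s t * z) \<le> norm z / (1 + \<bar>t\<bar>) * (2 + \<bar>s\<bar>)"
proof -
  have "norm (u_fun s t) * norm z \<le> (2 + \<bar>s\<bar>) / (1 + \<bar>t\<bar>) * norm z"
    by (intro mult_right_mono norm_u_fun_le_weight) auto
  then show ?thesis by (simp add: norm_mult mult.commute)
qed

section \<open>The primitive \<open>Psi\<close>: existence, growth and measurability\<close>

lemma integrable_u_fun_mult:
  assumes "tame f"
  shows "integrable lebesgue (\<lambda>t. u_fun s t * f t)"
proof -
  note [measurable] = assms[THEN tame_measurable]
  have "integrable lebesgue (\<lambda>t. norm (f t) / (1 + \<bar>t\<bar>) * (2 + \<bar>s\<bar>))" 
    using assms by (intro integrable_mult_left) (auto simp: tame_def)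
  then show ?thesis
  proof (rule Bochner_Integration.integrable_bound)
    show "AE t in lebesgue. norm (u_fun s t * f t) \<le> norm (norm (f t) / (1 + \<bar>t\<bar>) * (2 + \<bar>s\<bar>))"
      using norm_u_fun_mult_bound by (intro AE_I2) (auto intro: order_trans)
  qed measurable
qed

lemma norm_Psi_le:
  assumes "tame f"
  shows "norm (Psi f s) \<le> (LINT t|lebesgue. norm (f t) / (1 + \<bar>t\<bar>)) * (2 + \<bar>s\<bar>)"
proof -
  have "norm (Psi f s) \<le> (LINT t|lebesgue. norm (u_fun s t * f t))"
    unfolding Psi_def by (rule integral_norm_bound)
  also have "\<dots> \<le> (LINT t|lebesgue. norm (f t) / (1 + \<bar>t\<bar>) * (2 + \<bar>s\<bar>))"
    using assms by (intro integral_mono integrable_norm integrable_u_fun_mult integrable_mult_left norm_u_fun_mult_bound)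
      (auto simp: tame_def)
  finally show ?thesis by (simp only: integral_mult_left_zero)
qed

lemma Psi_add: "tame f \<Longrightarrow> tame g \<Longrightarrow> Psi (\<lambda>x. f x + g x) s = Psi f s + Psi g s"
  unfolding Psi_def by (simp add: distrib_left integrable_u_fun_mult)

lemma Psi_diff: "tame f \<Longrightarrow> tame g \<Longrightarrow> Psi (\<lambda>x. f x - g x) s = Psi f s - Psi g s"
  unfolding Psi_def by (simp add: right_diff_distrib integrable_u_fun_mult)

lemma Psi_cmult: "Psi (\<lambda>x. c * f x) s = c * Psi f s"
  unfolding Psi_def by (subst mult.left_commute) simp

lemma Psi_cong_AE:
  assumes "f \<in> borel_measurable lebesgue" "g \<in> borel_measurable lebesgue" "AE x in lebesgue. f x = g x"
  shows "Psi f = Psi g"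
proof -
  note [measurable] = assms(1,2)
  show ?thesis unfolding Psi_def using assms(3) by (intro ext integral_cong_AE) auto
qed

text \<open>Fubini is applied on the product of two copies of \<open>lborel\<close>, which asks for
  Borel integrands; a merely Lebesgue measurable function is first changed on a null set.\<close>

lemma borel_representative:
  fixes f :: "real \<Rightarrow> complex"
  assumes "f \<in> borel_measurable lebesgue"
  obtains g where "g \<in> borel_measurable borel" "AE x in lebesgue. f x = g x"
proof -
  have "(\<lambda>x. Re (f x)) \<in> borel_measurable lebesgue" "(\<lambda>x. Im (f x)) \<in> borel_measurable lebesgue" using assms by auto
  then obtain a b where [measurable]: "a \<in> borel_measurable lborel" "b \<in> borel_measurable lborel"
    and ab: "AE x in lborel. Re (f x) = a x" "AE x in lborel. Im (f x) = b x"
    by (metis completion_ex_borel_measurable_real)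
  have "AE x in lborel. f x = Complex (a x) (b x)" using ab by eventually_elim (auto simp: complex_eq_iff)
  moreover have "(\<lambda>x. Complex (a x) (b x)) \<in> borel_measurable borel" 
    unfolding Complex_eq by measurable
  ultimately show ?thesis using that by (auto simp: AE_completion_iff)
qed

lemma borel_measurable_Psi:
  assumes "tame f"
  shows "Psi f \<in> borel_measurable borel"
proof -
  obtain g where [measurable]: "g \<in> borel_measurable borel" and eq: "AE x in lebesgue. f x = g x"
    using borel_representative[of f] assms by (auto simp: tame_def)
  have "Psi f = Psi g" using assms eq by (intro Psi_cong_AE) (auto simp: tame_def measurable_completion)
  also have "\<dots> = (\<lambda>s. LINT t|lborel. u_fun s t * g t)"
    unfolding Psi_def by (subst integral_completion) auto
  also have "\<dots> \<in> borel_measurable borel" by measurable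
  finally show ?thesis .
qed

section \<open>Schwartz functions\<close>

lemma Schwartz_differentiable: "\<phi> \<in> Schwartz \<Longrightarrow> (vderiv ^^ k) \<phi> differentiable (at x)"
  by (simp add: Schwartz_def)

lemma Schwartz_vderiv:
  assumes "\<phi> \<in> Schwartz"
  shows "vderiv \<phi> \<in> Schwartz"
proof -
  have eq: "(vderiv ^^ k) (vderiv \<phi>) = (vderiv ^^ Suc k) \<phi>" for k
    by (simp add: funpow_swap1)
  show ?thesis using assms unfolding Schwartz_def mem_Collect_eq eq by blast
qed

lemma Schwartz_has_vector_derivative:
  "\<phi> \<in> Schwartz \<Longrightarrow> (\<phi> has_vector_derivative vderiv \<phi> x) (at x)"
  using Schwartz_differentiable[of \<phi> 0 x] by (simp add: vderiv_def vector_derivative_works)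

lemma Schwartz_continuous: "\<phi> \<in> Schwartz \<Longrightarrow> continuous_on A \<phi>"
  using Schwartz_has_vector_derivative
  by (meson continuous_at_imp_continuous_on has_vector_derivative_continuous)

lemma vderiv_lincomb:
  assumes "\<phi> \<in> Schwartz" "\<psi> \<in> Schwartz"
  shows "vderiv (\<lambda>x. c * \<phi> x + d * \<psi> x) = (\<lambda>x. c * vderiv \<phi> x + d * vderiv \<psi> x)"
proof
  fix x
  note [derivative_intros] = assms[THEN Schwartz_has_vector_derivative]
  show "vderiv (\<lambda>x. c * \<phi> x + d * \<psi> x) x = c * vderiv \<phi> x + d * vderiv \<psi> x"
    unfolding vderiv_def[of "\<lambda>x. c * \<phi> x + d * \<psi> x"]
    by (intro vector_derivative_at) (auto intro!: derivative_eq_intros)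
qed

lemma funpow_vderiv_lincomb:
  assumes "\<phi> \<in> Schwartz" "\<psi> \<in> Schwartz"
  shows "(vderiv ^^ k) (\<lambda>x. c * \<phi> x + d * \<psi> x) = (\<lambda>x. c * (vderiv ^^ k) \<phi> x + d * (vderiv ^^ k) \<psi> x)"
proof (induction k)
  case (Suc k)
  have "(vderiv ^^ k) \<phi> \<in> Schwartz" if "\<phi> \<in> Schwartz" for \<phi>
    using that by (induction k) (auto intro: Schwartz_vderiv)
  with Suc assms show ?case by (simp add: vderiv_lincomb)
qed simp

lemma Schwartz_lincomb:
  assumes "\<phi> \<in> Schwartz" "\<psi> \<in> Schwartz"
  shows "(\<lambda>x. c * \<phi> x + d * \<psi> x) \<in> Schwartz"
  unfolding Schwartz_def funpow_vderiv_lincomb[OF assms] mem_Collect_eq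
proof (intro conjI allI)
  show "(\<lambda>x. c * (vderiv ^^ k) \<phi> x + d * (vderiv ^^ k) \<psi> x) differentiable at x" for k x
    using assms by (intro derivative_intros Schwartz_differentiable)
  fix m k
  obtain A B where A: "\<And>x. \<bar>x\<bar> ^ m * norm ((vderiv ^^ k) \<phi> x) \<le> A" and B: "\<And>x. \<bar>x\<bar> ^ m * norm ((vderiv ^^ k) \<psi> x) \<le> B"
    using assms unfolding Schwartz_def by blast
  have "\<bar>x\<bar> ^ m * norm (c * (vderiv ^^ k) \<phi> x + d * (vderiv ^^ k) \<psi> x) \<le> norm c * A + norm d * B" for x
  proof -
    have "\<bar>x\<bar> ^ m * norm (c * (vderiv ^^ k) \<phi> x + d * (vderiv ^^ k) \<psi> x) \<le>
        \<bar>x\<bar> ^ m * (norm (c * (vderiv ^^ k) \<phi> x) + norm (d * (vderiv ^^ k) \<psi> x))"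
      by (intro mult_left_mono norm_triangle_ineq) auto
    also have "\<dots> = norm c * (\<bar>x\<bar> ^ m * norm ((vderiv ^^ k) \<phi> x)) + norm d * (\<bar>x\<bar> ^ m * norm ((vderiv ^^ k) \<psi> x))"
      by (simp add: norm_mult algebra_simps)
    also have "\<dots> \<le> norm c * A + norm d * B" by (intro add_mono mult_left_mono A B) auto
    finally show ?thesis .
  qed
  then show "\<exists>C. \<forall>x. \<bar>x\<bar> ^ m * norm (c * (vderiv ^^ k) \<phi> x + d * (vderiv ^^ k) \<psi> x) \<le> C" by blast
qed

lemma Schwartz_borel: "\<phi> \<in> Schwartz \<Longrightarrow> \<phi> \<in> borel_measurable borel"
  by (intro borel_measurable_continuous_onI Schwartz_continuous)

definition seminorm :: "nat \<Rightarrow> nat \<Rightarrow> (real \<Rightarrow> complex) \<Rightarrow> real" where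
  "seminorm m k \<phi> = (SUP x. \<bar>x\<bar> ^ m * norm ((vderiv ^^ k) \<phi> x))"

text \<open>Membership in \<open>Schwartz\<close> makes the range bounded above; only then does
  \<open>SUP\<close> over the reals bound the individual values.\<close>

lemma seminorm_upper:
  assumes "\<phi> \<in> Schwartz"
  shows "\<bar>x\<bar> ^ m * norm ((vderiv ^^ k) \<phi> x) \<le> seminorm m k \<phi>"
  unfolding seminorm_def using assms
  by (intro cSUP_upper) (auto simp: Schwartz_def bdd_above_def)

lemma seminorm_nonneg: "\<phi> \<in> Schwartz \<Longrightarrow> 0 \<le> seminorm m k \<phi>"
  using seminorm_upper[of \<phi> 1 m k] by (smt (verit) norm_ge_zero abs_ge_zero zero_le_power mult_nonneg_nonneg)

text \<open>The weight 2 + |x| is the growth of \<open>Psi\<close>, and the power on the right is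
  integrable. Together they account for degree three, hence the seminorms with m up to 3.\<close>

lemma Schwartz_decay:
  assumes "\<phi> \<in> Schwartz"
  shows "(2 + \<bar>x\<bar>) * norm ((vderiv ^^ k) \<phi> x) \<le>
     4 * (\<Sum>m\<le>3. seminorm m k \<phi>) * (1 + \<bar>x\<bar>) powr (-2)"
proof -
  let ?N = "norm ((vderiv ^^ k) \<phi> x)"
  have "(2 + \<bar>x\<bar>) * (1 + \<bar>x\<bar>)^2 \<le> 4 * (\<Sum>m\<le>3. \<bar>x\<bar> ^ m)"
  proof -
    have eq: "{..3::nat} = {0,1,2,3}" by auto
    have *: "4 * (\<Sum>m\<le>3. \<bar>x\<bar> ^ m) = 4 + 4 * \<bar>x\<bar> + 4 * \<bar>x\<bar>^2 + 4 * \<bar>x\<bar>^3"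
      unfolding eq by simp
    have **: "(2 + \<bar>x\<bar>) * (1 + \<bar>x\<bar>)^2 = 2 + 5 * \<bar>x\<bar> + 4 * \<bar>x\<bar>^2 + \<bar>x\<bar>^3"
      by (simp add: power2_eq_square power3_eq_cube algebra_simps)
    \<comment> \<open>What remains of 2 + 5y + 4y^2 + y^3 <= 4(1 + y + y^2 + y^3), y = |x|, after
      collecting terms.\<close>
    have "\<bar>x\<bar> \<le> 2 + 3 * \<bar>x\<bar>^3"
    proof (cases "\<bar>x\<bar> \<le> 1")
      case False
      then have "\<bar>x\<bar>^1 \<le> \<bar>x\<bar>^3" by (intro power_increasing) auto
      then show ?thesis using zero_le_power[of "\<bar>x\<bar>" 3] by (simp del: zero_le_power)
    qed (smt (verit) zero_le_power)
    then show ?thesis unfolding * ** by linarith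
  qed
  then have "(2 + \<bar>x\<bar>) * (1 + \<bar>x\<bar>)^2 * ?N \<le> 4 * (\<Sum>m\<le>3. \<bar>x\<bar> ^ m) * ?N"
    by (intro mult_right_mono) auto
  also have "\<dots> = 4 * (\<Sum>m\<le>3. \<bar>x\<bar> ^ m * ?N)"
    by (simp only: sum_distrib_right mult.assoc)
  also have "\<dots> \<le> 4 * (\<Sum>m\<le>3. seminorm m k \<phi>)"
    by (intro mult_left_mono sum_mono seminorm_upper assms) auto
  finally have "(2 + \<bar>x\<bar>) * ?N * (1 + \<bar>x\<bar>)^2 \<le> 4 * (\<Sum>m\<le>3. seminorm m k \<phi>)" by (simp add: mult_ac)
  then have "(2 + \<bar>x\<bar>) * ?N \<le> 4 * (\<Sum>m\<le>3. seminorm m k \<phi>) / (1 + \<bar>x\<bar>)^2"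
    using one_plus_abs_pos[of x] by (simp add: le_divide_eq)
  also have "\<dots> = 4 * (\<Sum>m\<le>3. seminorm m k \<phi>) * (1 + \<bar>x\<bar>) powr (-2)"
    using one_plus_abs_pos[of x] by (simp add: powr_minus powr_numeral field_simps)
  finally show ?thesis .
qed


section \<open>The transform as a tempered distribution\<close>

lemma integrable_Psi_mult:
  assumes "tame f" "\<phi> \<in> Schwartz"
  shows "integrable lebesgue (\<lambda>x. Psi f x * \<phi> x)"
    and "norm (LINT x|lebesgue. Psi f x * \<phi> x) \<le>
      4 * (LINT t|lebesgue. norm (f t) / (1 + \<bar>t\<bar>)) * (LINT x|lborel. (1 + \<bar>x::real\<bar>) powr (-2)) * (\<Sum>m\<le>3. seminorm m 0 \<phi>)"
proof -
  define A where "A = (LINT t|lebesgue. norm (f t) / (1 + \<bar>t\<bar>))"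
  define S where "S = (\<Sum>m\<le>3. seminorm m 0 \<phi>)"
  have A: "0 \<le> A" unfolding A_def by (intro integral_nonneg_AE AE_I2) auto
  have [measurable]: "Psi f \<in> borel_measurable borel" "\<phi> \<in> borel_measurable borel"
    using assms by (auto intro: borel_measurable_Psi Schwartz_borel)
  have bound: "norm (Psi f x * \<phi> x) \<le> 4 * A * S * (1 + \<bar>x\<bar>) powr (-2)" for x
  proof -
    have "norm (Psi f x * \<phi> x) \<le> A * (2 + \<bar>x\<bar>) * norm (\<phi> x)"
      unfolding norm_mult A_def by (intro mult_right_mono norm_Psi_le assms) auto
    also have "\<dots> = A * ((2 + \<bar>x\<bar>) * norm ((vderiv ^^ 0) \<phi> x))" by simp
    also have "\<dots> \<le> A * (4 * S * (1 + \<bar>x\<bar>) powr (-2))"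
      unfolding S_def by (intro mult_left_mono Schwartz_decay assms A)
    finally show ?thesis by (simp add: mult_ac)
  qed
  have i: "integrable lborel (\<lambda>x::real. 4 * A * S * (1 + \<bar>x\<bar>) powr (-2))"
    by (intro integrable_mult_right integrable_one_plus_abs_powr) auto
  have j: "integrable lborel (\<lambda>x. Psi f x * \<phi> x)"
    by (rule Bochner_Integration.integrable_bound[OF i]) (auto intro!: AE_I2 order_trans[OF bound])
  then show "integrable lebesgue (\<lambda>x. Psi f x * \<phi> x)"
    by (simp add: integrable_completion)
  have "norm (LINT x|lebesgue. Psi f x * \<phi> x) = norm (LINT x|lborel. Psi f x * \<phi> x)"
    by (simp add: integral_completion)
  also have "\<dots> \<le> (LINT x|lborel. norm (Psi f x * \<phi> x))" by (rule integral_norm_bound)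
  also have "\<dots> \<le> (LINT x|lborel. 4 * A * S * (1 + \<bar>x::real\<bar>) powr (-2))"
    by (intro integral_mono integrable_norm i j bound)
  also have "\<dots> = 4 * A * (LINT x|lborel. (1 + \<bar>x::real\<bar>) powr (-2)) * S" by simp
  finally show "norm (LINT x|lebesgue. Psi f x * \<phi> x) \<le>
      4 * (LINT t|lebesgue. norm (f t) / (1 + \<bar>t\<bar>)) * (LINT x|lborel. (1 + \<bar>x::real\<bar>) powr (-2)) * (\<Sum>m\<le>3. seminorm m 0 \<phi>)"
    by (simp add: A_def S_def)
qed

lemma fourier_apply:
  "\<phi> \<in> Schwartz \<Longrightarrow> fourier f \<phi> = - (LINT x|lebesgue. Psi f x * vderiv \<phi> x)"
  by (simp add: fourier_def dist_deriv_def regular_dist_def Schwartz_vderiv)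

lemma fourier_extensional: "fourier f \<in> extensional Schwartz"
  by (simp add: fourier_def dist_deriv_def)

lemma fourier_eqI:
  assumes "\<And>\<phi>. \<phi> \<in> Schwartz \<Longrightarrow> fourier f \<phi> = T \<phi>" "T \<in> extensional Schwartz"
  shows "fourier f = T"
  using assms fourier_extensional by (intro extensionalityI) auto

lemma fourier_add:
  assumes "tame g" "tame h"
  shows "fourier (\<lambda>x. g x + h x) = dist_add (fourier g) (fourier h)"
  by (rule fourier_eqI)
     (use assms in \<open>auto simp: fourier_apply dist_add_def Psi_add distrib_right integrable_Psi_mult Schwartz_vderiv\<close>)

lemma fourier_cmult: "fourier (\<lambda>x. c * g x) = dist_scale c (fourier g)"
  by (rule fourier_eqI) (auto simp: fourier_apply dist_scale_def Psi_cmult mult.assoc)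

lemma fourier_tempered:
  assumes "tame f"
  shows "fourier f \<in> tempered"
proof -
  define C where "C = 4 * (LINT t|lebesgue. norm (f t) / (1 + \<bar>t\<bar>)) * (LINT x|lborel. (1 + \<bar>x::real\<bar>) powr (-2))"
  have C: "0 \<le> C" unfolding C_def by (intro mult_nonneg_nonneg integral_nonneg_AE AE_I2) auto
  have lin: "fourier f (\<lambda>x. c * \<phi> x + d * \<psi> x) = c * fourier f \<phi> + d * fourier f \<psi>"
    if "\<phi> \<in> Schwartz" "\<psi> \<in> Schwartz" "(\<lambda>x. c * \<phi> x + d * \<psi> x) \<in> Schwartz" for c d \<phi> \<psi>
  proof -
    have i: "integrable lebesgue (\<lambda>x. c * (Psi f x * vderiv \<phi> x))" "integrable lebesgue (\<lambda>x. d * (Psi f x * vderiv \<psi> x))"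
      using that assms by (auto intro!: integrable_mult_right integrable_Psi_mult Schwartz_vderiv)
    have "(LINT x|lebesgue. Psi f x * vderiv (\<lambda>x. c * \<phi> x + d * \<psi> x) x) =
      (LINT x|lebesgue. c * (Psi f x * vderiv \<phi> x) + d * (Psi f x * vderiv \<psi> x))"
      by (intro Bochner_Integration.integral_cong) (auto simp: vderiv_lincomb that algebra_simps)
    also have "\<dots> = c * (LINT x|lebesgue. Psi f x * vderiv \<phi> x) + d * (LINT x|lebesgue. Psi f x * vderiv \<psi> x)"
      using i by simp
    finally show ?thesis using that by (simp add: fourier_apply)
  qed
  have bd: "norm (fourier f \<phi>) \<le> C * (\<Sum>m\<le>3. \<Sum>k\<le>3. SUP x. \<bar>x\<bar> ^ m * norm ((vderiv ^^ k) \<phi> x))"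
    if \<phi>: "\<phi> \<in> Schwartz" for \<phi>
  proof -
    \<comment> \<open>The transform pairs \<open>Psi\<close> with the derivative of \<phi>, so only
      seminorms with k = 1 arise; the other nonnegative ones are added to fill the square index
      range of \<open>tempered\<close>, with N = 3.\<close>
    have eq: "seminorm m 0 (vderiv \<phi>) = seminorm m 1 \<phi>" for m by (simp add: seminorm_def)
    have "norm (fourier f \<phi>) \<le> C * (\<Sum>m\<le>3. seminorm m 0 (vderiv \<phi>))"
      unfolding C_def fourier_apply[OF \<phi>] norm_minus_cancel by (intro integrable_Psi_mult assms Schwartz_vderiv \<phi>)
    also have "\<dots> \<le> C * (\<Sum>m\<le>3. \<Sum>k\<le>3. seminorm m k \<phi>)"
      unfolding eq by (intro mult_left_mono C sum_mono member_le_sum) (auto intro: seminorm_nonneg \<phi>)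
    finally show ?thesis by (simp add: seminorm_def)
  qed
  have "fourier f (\<lambda>x. c * \<phi> x + d * \<psi> x) = c * fourier f \<phi> + d * fourier f \<psi>"
    if "\<phi> \<in> Schwartz" "\<psi> \<in> Schwartz" for c d \<phi> \<psi>
    using lin that Schwartz_lincomb by blast
  with bd show ?thesis unfolding tempered_def using fourier_extensional by blast
qed

section \<open>Pairing with Schwartz functions\<close>

lemma integral_derivative_eq_0:
  fixes f F :: "real \<Rightarrow> complex"
  assumes "\<And>x. (F has_vector_derivative f x) (at x)" "continuous_on UNIV f" "integrable lborel f"
    "(F \<longlongrightarrow> 0) at_top" "(F \<longlongrightarrow> 0) at_bot"
  shows "(LINT x|lborel. f x) = 0"
proof -
  have "(LBINT x=-\<infinity>..\<infinity>. f x) = 0 - 0"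
    using assms by (intro interval_integral_FTC_integrable[where F=F])
      (simp_all add: continuous_on_eq_continuous_at set_integrable_def ereal_tendsto_simps)
  then show ?thesis by (simp add: interval_lebesgue_integral_def set_lebesgue_integral_def)
qed

lemma filterlim_one_plus_abs_powr:
  "((\<lambda>x::real. (1 + \<bar>x\<bar>) powr (-2)) \<longlongrightarrow> 0) at_top" "((\<lambda>x::real. (1 + \<bar>x\<bar>) powr (-2)) \<longlongrightarrow> 0) at_bot"
  by real_asymp+

lemma Schwartz_bound:
  assumes "\<phi> \<in> Schwartz"
  obtains C where "\<And>x. (2 + \<bar>x\<bar>) * norm (\<phi> x) \<le> C * (1 + \<bar>x\<bar>) powr (-2)"
  using Schwartz_decay[OF assms, of _ 0] by auto

lemma integrable_weight_Schwartz:
  assumes "\<phi> \<in> Schwartz"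
  shows "integrable lborel (\<lambda>x. (2 + \<bar>x\<bar>) * norm (\<phi> x))"
proof -
  note [measurable] = Schwartz_borel[OF assms]
  obtain C where C: "\<And>x. (2 + \<bar>x\<bar>) * norm (\<phi> x) \<le> C * (1 + \<bar>x\<bar>) powr (-2)"
    using Schwartz_bound[OF assms] by metis
  have "integrable lborel (\<lambda>x::real. C * (1 + \<bar>x\<bar>) powr (-2))"
    by (intro integrable_mult_right integrable_one_plus_abs_powr) auto
  then show ?thesis
  proof (rule Bochner_Integration.integrable_bound)
    show "AE x in lborel. norm ((2 + \<bar>x\<bar>) * norm (\<phi> x)) \<le> norm (C * (1 + \<bar>x\<bar>) powr (-2))"
    proof (rule AE_I2)
      fix x
      have "norm ((2 + \<bar>x\<bar>) * norm (\<phi> x)) = (2 + \<bar>x\<bar>) * norm (\<phi> x)" by (simp add: add_pos_nonneg abs_mult)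
      also note C[of x]
      finally show "norm ((2 + \<bar>x\<bar>) * norm (\<phi> x)) \<le> norm (C * (1 + \<bar>x\<bar>) powr (-2))" by auto
    qed
  qed measurable
qed

lemma integrable_mult_Schwartz:
  assumes "\<phi> \<in> Schwartz" "m \<in> borel_measurable borel" "\<And>x. norm (m x) \<le> 2 + \<bar>x\<bar>"
  shows "integrable lborel (\<lambda>x. m x * \<phi> x)"
proof -
  note [measurable] = Schwartz_borel[OF assms(1)] assms(2)
  show ?thesis
  proof (rule Bochner_Integration.integrable_bound[OF integrable_weight_Schwartz[OF assms(1)]])
    show "AE x in lborel. norm (m x * \<phi> x) \<le> norm ((2 + \<bar>x\<bar>) * norm (\<phi> x))"
      using assms(3) by (intro AE_I2) (auto simp: norm_mult abs_mult intro!: mult_right_mono)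
  qed measurable
qed

lemma tendsto_mult_Schwartz:
  assumes "\<phi> \<in> Schwartz" "\<And>x. norm (m x) \<le> 2 + \<bar>x\<bar>"
  shows "((\<lambda>x. m x * \<phi> x) \<longlongrightarrow> 0) at_top" "((\<lambda>x. m x * \<phi> x) \<longlongrightarrow> 0) at_bot"
proof -
  obtain C where C: "\<And>x. (2 + \<bar>x\<bar>) * norm (\<phi> x) \<le> C * (1 + \<bar>x\<bar>) powr (-2)"
    using Schwartz_bound[OF assms(1)] by metis
  have bd: "norm (m x * \<phi> x) \<le> C * (1 + \<bar>x\<bar>) powr (-2)" for x
  proof -
    have "norm (m x * \<phi> x) \<le> (2 + \<bar>x\<bar>) * norm (\<phi> x)"
      unfolding norm_mult by (intro mult_right_mono assms) auto
    with C[of x] show ?thesis by linarith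
  qed
  have 0: "((\<lambda>x. C * (1 + \<bar>x\<bar>) powr (-2)) \<longlongrightarrow> 0) at_top" "((\<lambda>x. C * (1 + \<bar>x\<bar>) powr (-2)) \<longlongrightarrow> 0) at_bot"
    using tendsto_mult_right_zero[OF filterlim_one_plus_abs_powr(1)] tendsto_mult_right_zero[OF filterlim_one_plus_abs_powr(2)] by blast+
  show "((\<lambda>x. m x * \<phi> x) \<longlongrightarrow> 0) at_top"
    by (rule Lim_null_comparison[OF always_eventually 0(1)]) (use bd in auto)
  show "((\<lambda>x. m x * \<phi> x) \<longlongrightarrow> 0) at_bot"
    by (rule Lim_null_comparison[OF always_eventually 0(2)]) (use bd in auto)
qed

lemma norm_exp_minus_ii [simp]: "norm (exp (- (\<i> * of_real s * of_real t))) = 1"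
  by (simp add: norm_exp_eq_Re)

lemma integral_vderiv_Schwartz:
  assumes "\<phi> \<in> Schwartz"
  shows "(LINT x|lborel. vderiv \<phi> x) = 0"
  using integrable_mult_Schwartz[OF Schwartz_vderiv[OF assms], of "\<lambda>_. 1"]
    tendsto_mult_Schwartz[OF assms, of "\<lambda>_. 1"]
  by (intro integral_derivative_eq_0[of \<phi>] Schwartz_has_vector_derivative assms Schwartz_continuous Schwartz_vderiv) auto

text \<open>Integration by parts in s. The kernel grows at most linearly in s, so its product with a
  Schwartz function vanishes at both ends and the derivative of that product has integral 0.\<close>

lemma integral_u_fun_vderiv:
  assumes "\<phi> \<in> Schwartz"
  shows "(LINT s|lborel. u_fun s t * vderiv \<phi> s) = - (LINT s|lborel. exp (- (\<i> * of_real s * of_real t)) * \<phi> s)"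
proof -
  have u: "norm (u_fun s t) \<le> 2 + \<bar>s\<bar>" for s using norm_u_fun_le[of s t] by linarith
  have i: "integrable lborel (\<lambda>s. u_fun s t * vderiv \<phi> s)"
    "integrable lborel (\<lambda>s. exp (- (\<i> * of_real s * of_real t)) * \<phi> s)"
    by (intro integrable_mult_Schwartz Schwartz_vderiv assms u; measurable; simp)+
  have "continuous_on UNIV (\<lambda>s. u_fun s t)"
    using u_fun_has_vector_derivative has_vector_derivative_continuous
    by (meson continuous_at_imp_continuous_on)
  then have "(LINT s|lborel. u_fun s t * vderiv \<phi> s + exp (- (\<i> * of_real s * of_real t)) * \<phi> s) = 0"
    using i assms
    by (intro integral_derivative_eq_0[of "\<lambda>s. u_fun s t * \<phi> s"] tendsto_mult_Schwartz assms u)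
       (auto intro!: continuous_intros Schwartz_continuous[OF assms] Schwartz_continuous[OF Schwartz_vderiv[OF assms]]
          has_vector_derivative_mult u_fun_has_vector_derivative Schwartz_has_vector_derivative)
  then show ?thesis using i by (simp add: eq_neg_iff_add_eq_0)
qed

lemma integrable_lborel_prod:
  fixes u v :: "real \<Rightarrow> real"
  assumes "integrable lborel u" "integrable lborel v"
  shows "integrable (lborel \<Otimes>\<^sub>M lborel) (\<lambda>(t, s). u t * v s)"
proof (rule lborel_pair.Fubini_integrable)
  show "integrable lborel (\<lambda>x. LINT y|lborel. norm (case (x, y) of (t, s) \<Rightarrow> u t * v s))"
    using integrable_mult_left[OF integrable_norm[OF assms(1)], of "LINT y|lborel. norm (v y)"] by (simp add: abs_mult)
  show "AE x in lborel. integrable lborel (\<lambda>y. case (x, y) of (t, s) \<Rightarrow> u t * v s)"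
    using assms(2) by simp
qed (use assms in measurable)

lemma fourier_eq_integral:
  assumes "tame f" "\<phi> \<in> Schwartz"
  shows "fourier f \<phi> = (LINT t|lebesgue. f t * (LINT s|lborel. exp (- (\<i> * of_real s * of_real t)) * \<phi> s))"
proof -
  obtain g where [measurable]: "g \<in> borel_measurable borel" and eq: "AE x in lebesgue. f x = g x"
    using borel_representative[of f] assms by (auto simp: tame_def)
  have [measurable]: "f \<in> borel_measurable lebesgue" "g \<in> borel_measurable lebesgue"
    using assms by (auto simp: tame_def measurable_completion)
  have Pfg: "Psi f = Psi g" using eq by (intro Psi_cong_AE) auto
  have [measurable]: "Psi g \<in> borel_measurable borel"
    using borel_measurable_Psi[OF assms(1)] Pfg by simp
  note [measurable] = Schwartz_borel[OF assms(2)] Schwartz_borel[OF Schwartz_vderiv[OF assms(2)]]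
  have "integrable lebesgue (\<lambda>t. norm (g t) / (1 + \<bar>t\<bar>))"
  proof -
    note [measurable] = measurable_ident_lebesgue
    have "integrable lebesgue (\<lambda>t. norm (g t) / (1 + \<bar>t\<bar>)) \<longleftrightarrow> integrable lebesgue (\<lambda>t. norm (f t) / (1 + \<bar>t\<bar>))"
      by (intro integrable_cong_AE) (measurable, use eq in auto)
    then show ?thesis using assms by (auto simp: tame_def)
  qed
  then have ig: "integrable lborel (\<lambda>t. norm (g t) / (1 + \<bar>t\<bar>))"
    by (simp add: integrable_completion)
  let ?H = "\<lambda>t s. g t * (u_fun s t * vderiv \<phi> s)"
  \<comment> \<open>A majorant of product form: the t factor is integrable by the weighted
    condition, the s factor by Schwartz decay. It makes the integrand integrable on the
    plane.\<close>
  have bound: "norm (?H t s) \<le> norm (g t) / (1 + \<bar>t\<bar>) * ((2 + \<bar>s\<bar>) * norm (vderiv \<phi> s))" for t s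
  proof -
    have "norm (?H t s) = norm (u_fun s t * g t) * norm (vderiv \<phi> s)" by (simp add: norm_mult)
    also have "\<dots> \<le> norm (g t) / (1 + \<bar>t\<bar>) * (2 + \<bar>s\<bar>) * norm (vderiv \<phi> s)"
      by (intro mult_right_mono norm_u_fun_mult_bound) auto
    finally show ?thesis by (simp add: mult.assoc)
  qed
  have "integrable (lborel \<Otimes>\<^sub>M lborel) (\<lambda>(t, s). norm (g t) / (1 + \<bar>t\<bar>) * ((2 + \<bar>s\<bar>) * norm (vderiv \<phi> s)))"
    by (intro integrable_lborel_prod ig integrable_weight_Schwartz Schwartz_vderiv assms)
  then have "integrable (lborel \<Otimes>\<^sub>M lborel) (case_prod ?H)"
  proof (rule Bochner_Integration.integrable_bound)
    show "AE x in lborel \<Otimes>\<^sub>M lborel. norm (case_prod ?H x) \<le>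
        norm (case x of (t, s) \<Rightarrow> norm (g t) / (1 + \<bar>t\<bar>) * ((2 + \<bar>s\<bar>) * norm (vderiv \<phi> s)))"
    proof (intro AE_I2, clarsimp simp only: prod.case split: prod.split)
      fix t s
      show "norm (?H t s) \<le> norm (norm (g t) / (1 + \<bar>t\<bar>) * ((2 + \<bar>s\<bar>) * norm (vderiv \<phi> s)))"
        by (rule order_trans[OF bound]) simp
    qed
  qed measurable
  from lborel_pair.Fubini_integral[OF this]
  have Fub: "(LINT s|lborel. LINT t|lborel. ?H t s) = (LINT t|lborel. LINT s|lborel. ?H t s)" .
  have "fourier f \<phi> = - (LINT s|lborel. Psi g s * vderiv \<phi> s)"
    unfolding fourier_apply[OF assms(2)] Pfg by (simp add: integral_completion)
  also have "(LINT s|lborel. Psi g s * vderiv \<phi> s) = (LINT s|lborel. LINT t|lborel. ?H t s)"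
  proof (intro Bochner_Integration.integral_cong refl)
    fix s
    have "Psi g s * vderiv \<phi> s = (LINT t|lborel. u_fun s t * g t) * vderiv \<phi> s"
      unfolding Psi_def by (simp add: integral_completion)
    also have "\<dots> = (LINT t|lborel. u_fun s t * g t * vderiv \<phi> s)" by simp
    also have "\<dots> = (LINT t|lborel. ?H t s)" by (simp add: mult_ac)
    finally show "Psi g s * vderiv \<phi> s = (LINT t|lborel. ?H t s)" .
  qed
  also note Fub
  also have "(LINT t|lborel. LINT s|lborel. ?H t s) = (LINT t|lborel. g t * - (LINT s|lborel. exp (- (\<i> * of_real s * of_real t)) * \<phi> s))"
    by (simp add: integral_u_fun_vderiv[OF assms(2)])
  also have "- \<dots> = (LINT t|lborel. g t * (LINT s|lborel. exp (- (\<i> * of_real s * of_real t)) * \<phi> s))" by simp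
  also have "\<dots> = (LINT t|lebesgue. g t * (LINT s|lborel. exp (- (\<i> * of_real s * of_real t)) * \<phi> s))"
    by (simp add: integral_completion)
  also have "\<dots> = (LINT t|lebesgue. f t * (LINT s|lborel. exp (- (\<i> * of_real s * of_real t)) * \<phi> s))"
  proof (rule integral_cong_AE)
    have [measurable]: "(\<lambda>t. LINT s|lborel. exp (- (\<i> * of_real s * of_real t)) * \<phi> s) \<in> borel_measurable lebesgue"
      by (intro measurable_completion) measurable
    show "(\<lambda>t. g t * (LINT s|lborel. exp (- (\<i> * of_real s * of_real t)) * \<phi> s)) \<in> borel_measurable lebesgue"
      "(\<lambda>t. f t * (LINT s|lborel. exp (- (\<i> * of_real s * of_real t)) * \<phi> s)) \<in> borel_measurable lebesgue"
      by measurable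
  qed (use eq in auto)
  finally show ?thesis .
qed

section \<open>Gaussians and uniqueness\<close>

text \<open>The polynomial factor makes the class closed under differentiation, as an induction over
  all derivatives needs. Imaginary b gives modulated Gaussians, real b translated ones up to a
  constant factor.\<close>

definition gaussian :: "real \<Rightarrow> complex \<Rightarrow> complex poly \<Rightarrow> real \<Rightarrow> complex" where
  "gaussian c b P s = poly P (of_real s) * exp (b * of_real s - of_real (c * s\<^sup>2))"

lemma vderiv_gaussian:
  "(gaussian c b P has_vector_derivative gaussian c b (pderiv P + [:b, - of_real (2 * c):] * P) s) (at s)"
proof -
  have "((\<lambda>z. poly P z * exp (b * z - of_real c * z\<^sup>2)) has_field_derivative
      poly (pderiv P) (of_real s) * exp (b * of_real s - of_real c * (of_real s)\<^sup>2) +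
      exp (b * of_real s - of_real c * (of_real s)\<^sup>2) * (b - of_real c * (2 * of_real s)) * poly P (of_real s)) (at (of_real s))"
    by (auto intro!: derivative_eq_intros)
  from has_vector_derivative_real_field[OF this] show ?thesis
    by (simp add: gaussian_def[abs_def] algebra_simps)
qed

lemma power_mult_exp_bounded:
  fixes c \<beta> :: real
  assumes "c > 0"
  shows "\<exists>C. \<forall>s. \<bar>s\<bar> ^ i * exp (\<beta> * s - c * s\<^sup>2) \<le> C"
proof -
  \<comment> \<open>Half of the Gaussian decay absorbs the power of s, through a single term of the
    exponential series; the other half absorbs the linear exponent, by completing the
    square.\<close>
  define d where "d = c / 2"
  have d: "d > 0" using assms by (simp add: d_def)
  have "\<bar>s\<bar> ^ i * exp (\<beta> * s - c * s\<^sup>2) \<le> (1 + fact i / d ^ i) * exp (\<beta>\<^sup>2 / (4 * d))" for s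
  proof -
    \<comment> \<open>An even power of s is a power of s^2 and can be compared with exp(d
      s^2).\<close>
    have "\<bar>s\<bar> ^ i \<le> 1 + (s\<^sup>2) ^ i"
    proof (cases "\<bar>s\<bar> \<le> 1")
      case True
      then have "\<bar>s\<bar> ^ i \<le> 1" by (simp add: power_le_one)
      moreover have "0 \<le> (s\<^sup>2) ^ i" by simp
      ultimately show ?thesis by linarith
    next
      case False
      then have "\<bar>s\<bar> ^ i \<le> \<bar>s\<bar> ^ (2 * i)" by (intro power_increasing) auto
      then show ?thesis by (simp add: power_mult)
    qed
    also have "(s\<^sup>2) ^ i = (d * s\<^sup>2) ^ i / fact i * (fact i / d ^ i)" using d by (simp add: power_mult_distrib)
    also have "(d * s\<^sup>2) ^ i / fact i \<le> exp (d * s\<^sup>2)"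
    proof -
      have "(\<Sum>k\<in>{i}. (d * s\<^sup>2) ^ k /\<^sub>R fact k) \<le> exp (d * s\<^sup>2)"
        unfolding exp_def using d by (intro sum_le_suminf summable_exp_generic) auto
      then show ?thesis by (simp add: divide_inverse mult.commute)
    qed
    also have "1 + exp (d * s\<^sup>2) * (fact i / d ^ i) \<le> exp (d * s\<^sup>2) * (1 + fact i / d ^ i)"
      using d by (simp add: algebra_simps)
    finally have "\<bar>s\<bar> ^ i \<le> exp (d * s\<^sup>2) * (1 + fact i / d ^ i)" using d by (simp add: divide_right_mono)
    then have "\<bar>s\<bar> ^ i * exp (\<beta> * s - c * s\<^sup>2) \<le> exp (d * s\<^sup>2) * (1 + fact i / d ^ i) * exp (\<beta> * s - c * s\<^sup>2)"
      by (intro mult_right_mono) auto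
    also have "\<dots> = (1 + fact i / d ^ i) * exp (\<beta> * s - d * s\<^sup>2)"
      by (simp add: d_def exp_add[symmetric] mult_exp_exp algebra_simps)
    also have "\<dots> \<le> (1 + fact i / d ^ i) * exp (\<beta>\<^sup>2 / (4 * d))"
    proof -
      have "0 \<le> (2 * d * s - \<beta>)\<^sup>2" by simp
      then have "\<beta> * s - d * s\<^sup>2 \<le> \<beta>\<^sup>2 / (4 * d)" using d by (simp add: field_simps power2_eq_square)
      then show ?thesis using d by (intro mult_left_mono) (auto intro: add_nonneg_nonneg)
    qed
    finally show ?thesis .
  qed
  then show ?thesis by blast
qed

text \<open>Induction on the coefficients: \<open>pCons\<close> multiplies by s, which is paid for
  by one more power in the weight, so m has to be arbitrary.\<close>

lemma gaussian_bounded: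
  assumes "c > 0"
  shows "\<exists>C. \<forall>s. \<bar>s\<bar> ^ m * norm (gaussian c b P s) \<le> C"
proof (induction P arbitrary: m)
  case 0
  show ?case by (auto simp: gaussian_def)
next
  case (pCons a P)
  obtain C where C: "\<And>s. \<bar>s\<bar> ^ Suc m * norm (gaussian c b P s) \<le> C" using pCons.IH by metis
  obtain D where D: "\<And>s. \<bar>s\<bar> ^ m * exp (Re b * s - c * s\<^sup>2) \<le> D" using power_mult_exp_bounded[OF assms] by metis
  have "\<bar>s\<bar> ^ m * norm (gaussian c b (pCons a P) s) \<le> norm a * D + C" for s
  proof -
    have "gaussian c b (pCons a P) s = a * exp (b * of_real s - of_real (c * s\<^sup>2)) + of_real s * gaussian c b P s"
      by (simp add: gaussian_def algebra_simps)
    then have "\<bar>s\<bar> ^ m * norm (gaussian c b (pCons a P) s) \<le>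
        \<bar>s\<bar> ^ m * (norm (a * exp (b * of_real s - of_real (c * s\<^sup>2))) + norm (of_real s * gaussian c b P s))"
      by (auto intro!: mult_left_mono norm_triangle_ineq)
    also have "\<dots> = norm a * (\<bar>s\<bar> ^ m * exp (Re b * s - c * s\<^sup>2)) + \<bar>s\<bar> ^ Suc m * norm (gaussian c b P s)"
      by (simp add: norm_mult norm_exp_eq_Re algebra_simps flip: of_real_power of_real_mult)
    also have "\<dots> \<le> norm a * D + C" by (intro add_mono mult_left_mono C D) auto
    finally show ?thesis .
  qed
  then show ?case by blast
qed

lemma gaussian_Schwartz:
  assumes "c > 0"
  shows "gaussian c b P \<in> Schwartz"
proof -
  have ex: "\<exists>Q. (vderiv ^^ k) (gaussian c b P) = gaussian c b Q" for k
  proof (induction k)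
    case (Suc k)
    then obtain Q where "(vderiv ^^ k) (gaussian c b P) = gaussian c b Q" by blast
    then have "(vderiv ^^ Suc k) (gaussian c b P) = vderiv (gaussian c b Q)" by simp
    also have "\<dots> = gaussian c b (pderiv Q + [:b, - of_real (2 * c):] * Q)"
      unfolding vderiv_def by (intro ext vector_derivative_at vderiv_gaussian)
    finally show ?case by blast
  qed auto
  show ?thesis unfolding Schwartz_def mem_Collect_eq
  proof (intro conjI allI)
    fix m k x
    obtain Q where Q: "(vderiv ^^ k) (gaussian c b P) = gaussian c b Q" using ex by blast
    show "(vderiv ^^ k) (gaussian c b P) differentiable (at x)"
      unfolding Q using vderiv_gaussian by (rule differentiableI_vector)
    show "\<exists>C. \<forall>x. \<bar>x\<bar> ^ m * norm ((vderiv ^^ k) (gaussian c b P) x) \<le> C"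
      unfolding Q using assms by (rule gaussian_bounded)
  qed
qed

lemma normal_density_eq_exp:
  assumes "\<sigma> > 0"
  shows "normal_density a \<sigma> t = 1 / sqrt (2 * pi * \<sigma>\<^sup>2) * exp (- (a\<^sup>2) / (2 * \<sigma>\<^sup>2)) * exp (a / \<sigma>\<^sup>2 * t - 1 / (2 * \<sigma>\<^sup>2) * t\<^sup>2)"
proof -
  have "-(t - a)\<^sup>2/ (2 * \<sigma>\<^sup>2) = - (a\<^sup>2) / (2 * \<sigma>\<^sup>2) + (a / \<sigma>\<^sup>2 * t - 1 / (2 * \<sigma>\<^sup>2) * t\<^sup>2)"
    using assms by (simp add: field_simps power2_eq_square)
  then show ?thesis by (simp add: normal_density_def exp_add[symmetric])
qed

lemma normal_density_Schwartz:
  assumes "\<sigma> > 0"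
  shows "(\<lambda>t. of_real (normal_density a \<sigma> t)) \<in> Schwartz"
proof -
  have "(\<lambda>t. complex_of_real (normal_density a \<sigma> t)) =
      gaussian (1 / (2 * \<sigma>\<^sup>2)) (of_real (a / \<sigma>\<^sup>2)) [: of_real (1 / sqrt (2 * pi * \<sigma>\<^sup>2) * exp (- (a\<^sup>2) / (2 * \<sigma>\<^sup>2))) :]"
    by (auto simp: gaussian_def normal_density_eq_exp[OF assms] exp_of_real[symmetric])
  then show ?thesis using gaussian_Schwartz assms by simp
qed

text \<open>The substitution s = z/\<sigma> turns this into the characteristic function of the
  standard normal law at (a - t)/\<sigma>. Modulation by a moves the centre of the transform to a,
  and the rate \<sigma>^2/2 makes its standard deviation \<sigma>.\<close>

lemma integral_exp_gaussian:
  assumes "\<sigma> > 0"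
  shows "(LINT s|lborel. exp (- (\<i> * of_real s * of_real t)) * gaussian (\<sigma>\<^sup>2 / 2) (\<i> * of_real a) 1 s)
    = of_real (2 * pi * normal_density a \<sigma> t)"
proof -
  have "(LINT s|lborel. exp (- (\<i> * of_real s * of_real t)) * gaussian (\<sigma>\<^sup>2 / 2) (\<i> * of_real a) 1 s)
     = \<bar>1 / \<sigma>\<bar> *\<^sub>R (LINT z|lborel. (\<lambda>s. exp (- (\<i> * of_real s * of_real t)) * gaussian (\<sigma>\<^sup>2 / 2) (\<i> * of_real a) 1 s) (0 + 1 / \<sigma> * z))"
    using assms by (intro lborel_integral_real_affine) auto
  also have "\<dots> = of_real (1 / \<sigma>) * (LINT z|lborel. of_real (sqrt (2 * pi)) * (std_normal_density z *\<^sub>R iexp ((a - t) / \<sigma> * z)))"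
  proof -
    have "exp (- (\<i> * of_real (0 + 1 / \<sigma> * z) * of_real t)) * gaussian (\<sigma>\<^sup>2 / 2) (\<i> * of_real a) 1 (0 + 1 / \<sigma> * z)
      = of_real (sqrt (2 * pi)) * (std_normal_density z *\<^sub>R iexp ((a - t) / \<sigma> * z))" for z
    proof -
      have "exp (- (\<i> * of_real (0 + 1 / \<sigma> * z) * of_real t)) * gaussian (\<sigma>\<^sup>2 / 2) (\<i> * of_real a) 1 (0 + 1 / \<sigma> * z)
         = exp (of_real (- z\<^sup>2 / 2) + \<i> * of_real ((a - t) / \<sigma> * z))"
      proof -
        have "\<sigma>\<^sup>2 / 2 * (0 + 1 / \<sigma> * z)\<^sup>2 = z\<^sup>2 / 2" using assms by (simp add: power_divide)
        moreover have "- (\<i> * of_real (0 + 1 / \<sigma> * z) * of_real t) + (\<i> * of_real a * of_real (0 + 1 / \<sigma> * z) - of_real (z\<^sup>2 / 2))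
          = of_real (- z\<^sup>2 / 2) + \<i> * of_real ((a - t) / \<sigma> * z)"
          using assms by (simp add: algebra_simps diff_divide_distrib)
        ultimately show ?thesis by (simp only: gaussian_def exp_add[symmetric] poly_1 mult_1_left)
      qed
      also have "\<dots> = of_real (exp (- z\<^sup>2 / 2)) * iexp ((a - t) / \<sigma> * z)"
        by (simp only: exp_add exp_of_real)
      also have "exp (- z\<^sup>2 / 2) = sqrt (2 * pi) * std_normal_density z"
        by (simp add: std_normal_density_def)
      finally show ?thesis by (simp add: scaleR_conv_of_real mult.assoc)
    qed
    then show ?thesis using assms by (simp add: scaleR_conv_of_real)
  qed
  also have "\<dots> = of_real (1 / \<sigma> * sqrt (2 * pi)) * (LINT z|lborel. std_normal_density z *\<^sub>R iexp ((a - t) / \<sigma> * z))"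
    by (subst integral_mult_right_zero) (simp only: of_real_mult mult.assoc)
  also have "(LINT z|lborel. std_normal_density z *\<^sub>R iexp ((a - t) / \<sigma> * z)) = char std_normal_distribution ((a - t) / \<sigma>)"
    unfolding char_def by (subst integral_density) auto
  also have "\<dots> = of_real (exp (- (((a - t) / \<sigma>)\<^sup>2) / 2))" by (simp only: char_std_normal_distribution)
  also have "of_real (1 / \<sigma> * sqrt (2 * pi)) * of_real (exp (- (((a - t) / \<sigma>)\<^sup>2) / 2)) = complex_of_real (2 * pi * normal_density a \<sigma> t)"
  proof -
    have "((a - t) / \<sigma>)\<^sup>2 / 2 = (t - a)\<^sup>2 / (2 * \<sigma>\<^sup>2)" by (simp add: power2_commute power_divide)
    moreover have "1 / \<sigma> * sqrt (2 * pi) = 2 * pi * (1 / sqrt (2 * pi * \<sigma>\<^sup>2))"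
      using assms by (simp add: real_sqrt_mult field_simps)
    ultimately show ?thesis by (simp add: normal_density_def flip: of_real_mult)
  qed
  finally show ?thesis .
qed

section \<open>Smoothed indicators of half-lines\<close>

lemma normal_density_swap: "normal_density \<mu> \<sigma> x = normal_density x \<sigma> \<mu>"
  by (simp add: normal_density_def power2_commute)

lemma borel_measurable_normal_density_mean [measurable]:
  "(\<lambda>(t, b). normal_density b r t) \<in> borel_measurable (borel \<Otimes>\<^sub>M borel)"
  unfolding normal_density_def by measurable

lemma integrable_normal_density_mean: "r > 0 \<Longrightarrow> integrable lborel (\<lambda>b. normal_density b r t)"
  by (subst normal_density_swap) simp

lemma integral_normal_density_mean: "r > 0 \<Longrightarrow> (LINT b|lborel. normal_density b r t) = 1"
  by (subst normal_density_swap) simp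

text \<open>The smoothed indicator is the probability that t + rZ <= c for a standard normal Z. In
  this form r has left the density, so one majorant serves all r as r tends to 0.\<close>

lemma integral_atMost_normal_density:
  assumes "r > 0"
  shows "(LINT b|lborel. indicator {..c} b * normal_density b r t)
    = (LINT z|lborel. std_normal_density z * indicator {..c} (t + r * z))"
proof -
  have "(LINT b|lborel. indicator {..c} b * normal_density b r t)
      = \<bar>r\<bar> *\<^sub>R (LINT z|lborel. indicator {..c} (t + r * z) * normal_density (t + r * z) r t)"
    using assms by (intro lborel_integral_real_affine) auto
  also have "\<dots> = (LINT z|lborel. r * (indicator {..c} (t + r * z) * normal_density (t + r * z) r t))"
    using assms by simp
  also have "\<dots> = (LINT z|lborel. std_normal_density z * indicator {..c} (t + r * z))"
  proof (intro Bochner_Integration.integral_cong refl)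
    fix z
    have "r * normal_density (t + r * z) r t = std_normal_density z"
      using assms by (simp add: normal_density_def real_sqrt_mult power_mult_distrib)
    then show "r * (indicator {..c} (t + r * z) * normal_density (t + r * z) r t) = std_normal_density z * indicator {..c} (t + r * z)"
      by (metis mult.commute mult.left_commute)
  qed
  finally show ?thesis .
qed

text \<open>Away from c the indicator is locally constant, so the integrand is eventually constant
  in n. At t = c the integral is 1/2 for every n, so that point has to be excluded.\<close>

lemma integral_atMost_normal_density_tendsto:
  assumes "t \<noteq> c"
  shows "(\<lambda>n. LINT b|lborel. indicator {..c} b * normal_density b (1 / real (Suc n)) t) \<longlonglongrightarrow> indicator {..c} t"
proof -
  have "(\<lambda>n. LINT z|lborel. std_normal_density z * indicator {..c} (t + 1 / real (Suc n) * z))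
      \<longlonglongrightarrow> (LINT z|lborel. std_normal_density z * indicator {..c} t)"
  proof (rule integral_dominated_convergence)
    show "integrable lborel std_normal_density" by simp
    show "AE z in lborel. (\<lambda>n. std_normal_density z * indicator {..c} (t + 1 / real (Suc n) * z)) \<longlonglongrightarrow> std_normal_density z * indicator {..c} t"
    proof (rule AE_I2, intro tendsto_intros)
      fix z
      have "(\<lambda>n. t + 1 / real (Suc n) * z) \<longlonglongrightarrow> t + 0 * z"
        by (intro tendsto_intros LIMSEQ_Suc lim_1_over_n[unfolded lim_sequentially[symmetric]]) 
      then have lim: "(\<lambda>n. t + 1 / real (Suc n) * z) \<longlonglongrightarrow> t" by simp
      consider "t < c" | "t > c" using assms by linarith
      then have "\<forall>\<^sub>F n in sequentially. indicator {..c} (t + 1 / real (Suc n) * z) = (indicator {..c} t :: real)"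
      proof cases
        case 1
        from order_tendstoD(2)[OF lim 1] show ?thesis by eventually_elim (use 1 in auto)
      next
        case 2
        from order_tendstoD(1)[OF lim 2] show ?thesis by eventually_elim (use 2 in auto)
      qed
      then show "(\<lambda>n. indicator {..c} (t + 1 / real (Suc n) * z)) \<longlonglongrightarrow> (indicator {..c} t :: real)"
        by (rule tendsto_eventually)
    qed
  qed (auto simp: indicator_def)
  then show ?thesis by (simp add: integral_atMost_normal_density)
qed

text \<open>Half-lines are an intersection-stable generator, so vanishing spreads to all Borel sets
  by Dynkin's argument, and an integrable function whose integrals over all of them vanish is 0
  a.e.\<close>

lemma AE_eq_0_if_integral_atMost_eq_0:
  fixes K :: "real \<Rightarrow> complex"
  assumes K: "integrable lborel K" and 0: "\<And>c. (LINT t|lborel. indicator {..c} t *\<^sub>R K t) = 0"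
  shows "AE t in lborel. K t = 0"
proof (rule sigma_finite_measure.density_zero[OF sigma_finite_lborel K])
  note [measurable] = borel_measurable_integrable[OF K]
  have i: "integrable lborel (\<lambda>t. indicator A t *\<^sub>R K t)" if "A \<in> sets borel" for A
    using K that by (intro integrable_mult_indicator) auto
  \<comment> \<open>The complement step needs the integral over the whole line, obtained as the
    limit over growing half-lines.\<close>
  have "(\<lambda>n. LINT t|lborel. indicator {..real n} t *\<^sub>R K t) \<longlonglongrightarrow> (LINT t|lborel. K t)"
  proof (rule integral_dominated_convergence)
    show "integrable lborel (\<lambda>t. norm (K t))" using K by simp
    show "AE t in lborel. (\<lambda>n. indicator {..real n} t *\<^sub>R K t) \<longlonglongrightarrow> K t"
    proof (rule AE_I2, rule tendsto_eventually)
      fix t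
      show "\<forall>\<^sub>F n in sequentially. indicator {..real n} t *\<^sub>R K t = K t"
        using eventually_ge_at_top[of "nat \<lceil>t\<rceil>"] by eventually_elim (auto simp: indicator_def)
    qed
  qed (auto simp: indicator_def)
  then have tot: "(LINT t|lborel. K t) = 0"
    unfolding 0 by (simp add: LIMSEQ_const_iff)
  fix A :: "real set" assume "A \<in> sets lborel"
  then have sA: "A \<in> sigma_sets UNIV (range (\<lambda>a::real. {..a}))"
    by (metis borel_eq_atMost sets_lborel sets_measure_of top_greatest Pow_UNIV)
  have "Int_stable (range (\<lambda>a::real. {..a}))"
    by (auto simp: Int_stable_def)
  moreover have "range (\<lambda>a::real. {..a}) \<subseteq> Pow UNIV" by simp
  ultimately show "set_lebesgue_integral lborel A K = 0"
    using sA unfolding set_lebesgue_integral_def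
  proof (induction rule: sigma_sets_induct_disjoint)
    case (compl A)
    then have A: "A \<in> sets borel" by (metis borel_eq_atMost sets_measure_of top_greatest Pow_UNIV)
    have "(LINT t|lborel. indicator (UNIV - A) t *\<^sub>R K t) = (LINT t|lborel. K t - indicator A t *\<^sub>R K t)"
      by (intro Bochner_Integration.integral_cong) (auto simp: indicator_def)
    also have "\<dots> = 0" using K i[OF A] compl tot by simp
    finally show ?case .
  next
    case (union A)
    then have A: "A i \<in> sets borel" for i by (metis borel_eq_atMost sets_measure_of top_greatest Pow_UNIV range_subsetD)
    have "set_lebesgue_integral lborel (\<Union>i. A i) K = (\<Sum>i. set_lebesgue_integral lborel (A i) K)"
      using union A i[of "\<Union>i. A i"] by (intro lebesgue_integral_countable_add) (auto simp: disjoint_family_on_def set_integrable_def)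
    also have "\<dots> = 0" using union by (simp add: set_lebesgue_integral_def)
    finally show ?case by (simp add: set_lebesgue_integral_def)
  qed (use 0 in auto)
qed

text \<open>Integrating the hypothesis over \<open>b \<le> c\<close> pairs \<open>K\<close> with a smoothed indicator of \<open>{..c}\<close>;
  then \<open>r\<close> tends to \<open>0\<close>.\<close>

lemma AE_eq_0_if_normal_integrals_eq_0:
  fixes K :: "real \<Rightarrow> complex"
  assumes K: "integrable lborel K"
    and 0: "\<And>b r. r > 0 \<Longrightarrow> (LINT t|lborel. K t * of_real (normal_density b r t)) = 0"
  shows "AE t in lborel. K t = 0"
proof (rule AE_eq_0_if_integral_atMost_eq_0[OF K])
  fix c :: real
  note [measurable] = borel_measurable_integrable[OF K]
  define H where "H r t = (LINT b|lborel. indicator {..c} b * normal_density b r t)" for r t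
  have [measurable]: "H r \<in> borel_measurable borel" for r
    unfolding H_def by measurable
  have ii: "integrable lborel (\<lambda>b. indicator {..c} b * normal_density b r t)" if "r > 0" for r t
    using integrable_mult_indicator[OF _ integrable_normal_density_mean[OF that], of "{..c}" t] by simp
  have H01: "0 \<le> H r t" "H r t \<le> 1" if "r > 0" for r t
  proof -
    show "0 \<le> H r t" unfolding H_def by (intro integral_nonneg_AE AE_I2) auto
    have "H r t \<le> (LINT b|lborel. normal_density b r t)"
      unfolding H_def using ii[OF that] integrable_normal_density_mean[OF that]
      by (intro integral_mono) (auto simp: indicator_def)
    then show "H r t \<le> 1" by (simp add: integral_normal_density_mean that)
  qed
  have KH: "(LINT t|lborel. of_real (H r t) * K t) = 0" if r: "r > 0" for r
  proof -
    let ?f = "\<lambda>t b. of_real (indicator {..c} b * normal_density b r t) * K t"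
    have nf: "(LINT b|lborel. norm (?f t b)) = H r t * norm (K t)" for t
      by (simp add: norm_mult abs_mult H_def)
    \<comment> \<open>The smoothed indicator is at most 1, so the integrability of \<open>K\<close>
      carries over to the plane.\<close>
    have "integrable lborel (\<lambda>t. H r t * norm (K t))"
      by (rule Bochner_Integration.integrable_bound[OF integrable_norm[OF K]])
         (use H01[OF r] in \<open>auto simp: abs_mult intro!: AE_I2 mult_left_le_one_le\<close>)
    then have "integrable (lborel \<Otimes>\<^sub>M lborel) (case_prod ?f)"
      by (intro lborel_pair.Fubini_integrable AE_I2)
         (simp_all only: prod.case nf integrable_mult_left integrable_of_real ii r, measurable)
    from lborel_pair.Fubini_integral[OF this]
    have "(LINT b|lborel. LINT t|lborel. ?f t b) = (LINT t|lborel. LINT b|lborel. ?f t b)" .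
    moreover have "(LINT b|lborel. ?f t b) = of_real (H r t) * K t" for t
    proof -
      have "(LINT b|lborel. ?f t b) = (LINT b|lborel. complex_of_real (indicator {..c} b * normal_density b r t)) * K t"
        by (rule integral_mult_left_zero)
      then show ?thesis unfolding H_def integral_complex_of_real .
    qed
    moreover have "(LINT t|lborel. ?f t b) = 0" for b
    proof -
      have "(LINT t|lborel. ?f t b) = (LINT t|lborel. of_real (indicator {..c} b) * (K t * of_real (normal_density b r t)))"
        by (intro Bochner_Integration.integral_cong) auto
      also have "\<dots> = 0" by (simp only: integral_mult_right_zero 0[OF r] mult_zero_right)
      finally show ?thesis .
    qed
    ultimately show ?thesis by (simp only: integral_zero)
  qed
  have "(\<lambda>n. LINT t|lborel. of_real (H (1 / real (Suc n)) t) * K t) \<longlonglongrightarrow> (LINT t|lborel. indicator {..c} t *\<^sub>R K t)"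
  proof (rule integral_dominated_convergence)
    show "integrable lborel (\<lambda>t. norm (K t))" using K by simp
    \<comment> \<open>The one point where the pointwise limit fails is a null set.\<close>
    have "AE t in lborel. t \<noteq> c" by (rule AE_lborel_singleton)
    then show "AE t in lborel. (\<lambda>n. of_real (H (1 / real (Suc n)) t) * K t) \<longlonglongrightarrow> indicator {..c} t *\<^sub>R K t"
    proof eventually_elim
      case (elim t)
      have "(\<lambda>n. H (1 / real (Suc n)) t) \<longlonglongrightarrow> indicator {..c} t"
        unfolding H_def by (rule integral_atMost_normal_density_tendsto[OF elim])
      then have "(\<lambda>n. H (1 / real (Suc n)) t *\<^sub>R K t) \<longlonglongrightarrow> indicator {..c} t *\<^sub>R K t"
        by (intro tendsto_intros)
      then show ?case by (simp add: scaleR_conv_of_real)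
    qed
    show "AE t in lborel. norm (of_real (H (1 / real (Suc n)) t) * K t) \<le> norm (K t)" for n
      using H01[of "1 / real (Suc n)"] by (intro AE_I2) (auto simp: norm_mult intro!: mult_left_le_one_le)
  qed auto
  then show "(LINT t|lborel. indicator {..c} t *\<^sub>R K t) = 0"
    by (simp add: KH LIMSEQ_const_iff)
qed

text \<open>A Gaussian factor makes \<open>k\<close> integrable, and the product of two Gaussians is a multiple of a
  third one.\<close>

lemma tame_AE_eq_0:
  assumes "tame k" and 0: "\<And>a \<sigma>. \<sigma> > 0 \<Longrightarrow> (LINT t|lebesgue. k t * of_real (normal_density a \<sigma> t)) = 0"
  shows "AE t in lebesgue. k t = 0"
proof -
  obtain g where [measurable]: "g \<in> borel_measurable borel" and eq: "AE x in lebesgue. k x = g x"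
    using borel_representative[of k] assms by (auto simp: tame_def)
  note [measurable] = assms(1)[THEN tame_measurable] measurable_completion[of g lborel]
  define K where "K t = g t * of_real (normal_density 0 1 t)" for t
  have [measurable]: "K \<in> borel_measurable borel" unfolding K_def by measurable
  \<comment> \<open>This bounds \<open>K\<close> by 2|k(t)|/(1 + |t|) a.e., so the weighted
    condition on k yields plain integrability of \<open>K\<close>.\<close>
  have nd1: "(1 + \<bar>t\<bar>) * normal_density 0 1 t \<le> 2" for t :: real
  proof -
    have "1 + \<bar>t\<bar> \<le> 2 * (1 + t\<^sup>2 / 2)"
      using sum_squares_bound[of "\<bar>t\<bar>" 1] by (simp add: power2_eq_square)
    also have "\<dots> \<le> 2 * exp (t\<^sup>2 / 2)" by (intro mult_left_mono exp_ge_add_one_self) auto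
    finally have "(1 + \<bar>t\<bar>) * exp (- t\<^sup>2 / 2) \<le> 2 * exp (t\<^sup>2 / 2) * exp (- t\<^sup>2 / 2)"
      by (intro mult_right_mono) auto
    also have "\<dots> = 2" by (simp add: mult.assoc flip: exp_add)
    finally have *: "(1 + \<bar>t\<bar>) * exp (- t\<^sup>2 / 2) \<le> 2" .
    have "sqrt 1 \<le> sqrt (2 * pi)" using pi_gt3 by (intro real_sqrt_le_mono) auto
    then have "(1 + \<bar>t\<bar>) * exp (- t\<^sup>2 / 2) / sqrt (2 * pi) \<le> 2 / 1"
      by (intro frac_le *) auto
    then show ?thesis by (simp add: std_normal_density_def)
  qed
  have "integrable lebesgue (\<lambda>t. 2 * (norm (k t) / (1 + \<bar>t\<bar>)))"
    using assms(1) by (intro integrable_mult_right) (simp add: tame_def)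
  then have "integrable lebesgue K"
  proof (rule Bochner_Integration.integrable_bound)
    show "K \<in> borel_measurable lebesgue" by (intro measurable_completion) measurable
    show "AE t in lebesgue. norm (K t) \<le> norm (2 * (norm (k t) / (1 + \<bar>t\<bar>)))"
      using eq
    proof eventually_elim
      case (elim t)
      have "norm (K t) = norm (k t) / (1 + \<bar>t\<bar>) * ((1 + \<bar>t\<bar>) * normal_density 0 1 t)"
        using one_plus_abs_pos[of t] by (simp add: K_def elim norm_mult)
      also have "\<dots> \<le> norm (k t) / (1 + \<bar>t\<bar>) * 2"
        by (intro mult_left_mono nd1) auto
      finally show ?case by (simp add: mult.commute)
    qed
  qed
  then have "integrable lborel K" by (simp add: integrable_completion)
  then have "AE t in lborel. K t = 0"
  proof (rule AE_eq_0_if_normal_integrals_eq_0)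
    fix b r :: real assume r: "r > 0"
    \<comment> \<open>Precisions add when Gaussians are multiplied: 1/\<sigma>^2 = 1 + 1/r^2, and
      the new centre is \<sigma>^2 b/r^2. What is left is free of t and becomes
      \<open>C\<close>.\<close>
    define \<sigma> where "\<sigma> = r / sqrt (1 + r\<^sup>2)"
    define a where "a = b / (1 + r\<^sup>2)"
    have s: "\<sigma> > 0" "\<sigma>\<^sup>2 = r\<^sup>2 / (1 + r\<^sup>2)" using r by (auto simp: \<sigma>_def power_divide add_pos_nonneg)
    have 1: "1 + r\<^sup>2 > 0" by (simp add: add_pos_nonneg)
    obtain C where C: "\<And>t. normal_density 0 1 t * normal_density b r t = C * normal_density a \<sigma> t"
    proof -
      have e: "a / \<sigma>\<^sup>2 = b / r\<^sup>2" "1 / (2 * \<sigma>\<^sup>2) = 1 / 2 + 1 / (2 * r\<^sup>2)"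
        using r 1 by (simp_all add: s a_def) (simp_all add: field_simps)
      define c1 c2 c3 where "c1 = 1 / sqrt (2 * pi * 1\<^sup>2) * exp (- (0\<^sup>2) / (2 * 1\<^sup>2))"
        and "c2 = 1 / sqrt (2 * pi * r\<^sup>2) * exp (- (b\<^sup>2) / (2 * r\<^sup>2))"
        and "c3 = 1 / sqrt (2 * pi * \<sigma>\<^sup>2) * exp (- (a\<^sup>2) / (2 * \<sigma>\<^sup>2))"
      have c3: "c3 > 0" using s(1) by (simp add: c3_def)
      have "normal_density 0 1 t * normal_density b r t = c1 * c2 / c3 * normal_density a \<sigma> t" for t
      proof -
        have "normal_density 0 1 t * normal_density b r t
           = c1 * c2 * (exp (0 / 1\<^sup>2 * t - 1 / (2 * 1\<^sup>2) * t\<^sup>2) * exp (b / r\<^sup>2 * t - 1 / (2 * r\<^sup>2) * t\<^sup>2))"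
          unfolding c1_def c2_def by (simp only: normal_density_eq_exp[OF r] normal_density_eq_exp[of 1, OF zero_less_one] mult_ac)
        also have "\<dots> = c1 * c2 * exp (a / \<sigma>\<^sup>2 * t - 1 / (2 * \<sigma>\<^sup>2) * t\<^sup>2)"
          unfolding exp_add[symmetric] e by (simp add: algebra_simps)
        also have "\<dots> = c1 * c2 / c3 * normal_density a \<sigma> t"
          unfolding normal_density_eq_exp[OF s(1), of a t] c3_def[symmetric] using c3 by simp
        finally show ?thesis .
      qed
      then show ?thesis using that by blast
    qed
    have "(LINT t|lborel. K t * of_real (normal_density b r t)) = (LINT t|lebesgue. K t * of_real (normal_density b r t))"
      by (simp add: integral_completion)
    also have "\<dots> = (LINT t|lebesgue. of_real C * (k t * of_real (normal_density a \<sigma> t)))"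
    proof (rule integral_cong_AE)
      have [measurable]: "(\<lambda>t. of_real (normal_density a \<sigma> t) :: complex) \<in> borel_measurable lebesgue" for a \<sigma>
        by (intro measurable_completion) measurable
      have [measurable]: "K \<in> borel_measurable lebesgue"
        by (intro measurable_completion) measurable
      show "(\<lambda>t. K t * of_real (normal_density b r t)) \<in> borel_measurable lebesgue"
        "(\<lambda>t. of_real C * (k t * of_real (normal_density a \<sigma> t))) \<in> borel_measurable lebesgue"
        by measurable
      show "AE t in lebesgue. K t * of_real (normal_density b r t) = of_real C * (k t * of_real (normal_density a \<sigma> t))"
        using eq
      proof eventually_elim
        case (elim t)
        have "K t * of_real (normal_density b r t) = g t * of_real (normal_density 0 1 t * normal_density b r t)"
          by (simp add: K_def)
        then show ?case unfolding C elim by simp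
      qed
    qed
    also have "\<dots> = 0" by (simp only: integral_mult_right_zero 0[OF s(1)] mult_zero_right)
    finally show "(LINT t|lborel. K t * of_real (normal_density b r t)) = 0" .
  qed
  then have "AE t in lebesgue. K t = 0" by (rule AE_completion)
  with eq show ?thesis
  proof eventually_elim
    case (elim t)
    moreover have "normal_density 0 1 t > 0" by (rule normal_density_pos) auto
    ultimately show ?case by (simp add: K_def)
  qed
qed

section \<open>Injectivity of the transform and of regular distributions\<close>

lemma fourier_inj:
  assumes "tame g" "tame h"
  shows "fourier g = fourier h \<longleftrightarrow> (AE x in lebesgue. g x = h x)"
proof
  assume "AE x in lebesgue. g x = h x"
  then show "fourier g = fourier h"
    using Psi_cong_AE[of g h] assms by (simp add: fourier_def tame_measurable)
next
  assume eq: "fourier g = fourier h"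
  have d: "tame (\<lambda>x. g x - h x)" using assms by (rule tame_diff)
  have "AE x in lebesgue. g x - h x = 0"
  proof (rule tame_AE_eq_0[OF d])
    fix a \<sigma> :: real assume s: "\<sigma> > 0"
    define \<phi> where "\<phi> = gaussian (\<sigma>\<^sup>2 / 2) (\<i> * of_real a) 1"
    have \<phi>: "\<phi> \<in> Schwartz" unfolding \<phi>_def using s by (intro gaussian_Schwartz) auto
    note \<phi>' = Schwartz_vderiv[OF \<phi>]
    have "0 = fourier g \<phi> - fourier h \<phi>" by (simp add: eq)
    also have "\<dots> = - (LINT x|lebesgue. Psi g x * vderiv \<phi> x - Psi h x * vderiv \<phi> x)"
      using assms by (simp add: fourier_apply \<phi> integrable_Psi_mult \<phi>')
    also have "\<dots> = fourier (\<lambda>x. g x - h x) \<phi>"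
      by (simp add: fourier_apply \<phi> Psi_diff assms left_diff_distrib)
    also have "\<dots> = (LINT t|lebesgue. of_real (2 * pi) * ((g t - h t) * of_real (normal_density a \<sigma> t)))"
      unfolding fourier_eq_integral[OF d \<phi>]
      by (intro Bochner_Integration.integral_cong) (simp_all add: \<phi>_def integral_exp_gaussian[OF s])
    also have "\<dots> = of_real (2 * pi) * (LINT t|lebesgue. (g t - h t) * of_real (normal_density a \<sigma> t))"
      by (rule integral_mult_right_zero)
    finally show "(LINT t|lebesgue. (g t - h t) * of_real (normal_density a \<sigma> t)) = 0" by simp
  qed
  then show "AE x in lebesgue. g x = h x" by auto
qed

lemma integrable_tame_mult_Schwartz:
  assumes "tame h" "\<phi> \<in> Schwartz"
  shows "integrable lebesgue (\<lambda>x. h x * \<phi> x)"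
proof -
  have [measurable]: "\<phi> \<in> borel_measurable lebesgue"
    using Schwartz_borel[OF assms(2)] by (intro measurable_completion) simp
  note [measurable] = assms(1)[THEN tame_measurable]
  obtain C where C: "\<And>x. (2 + \<bar>x\<bar>) * norm (\<phi> x) \<le> C * (1 + \<bar>x\<bar>) powr (-2)"
    using Schwartz_bound[OF assms(2)] by metis
  have "integrable lebesgue (\<lambda>t. \<bar>C\<bar> * (norm (h t) / (1 + \<bar>t\<bar>)))"
    using assms(1) by (intro integrable_mult_right) (simp add: tame_def)
  then show ?thesis
  proof (rule Bochner_Integration.integrable_bound)
    show "AE x in lebesgue. norm (h x * \<phi> x) \<le> norm (\<bar>C\<bar> * (norm (h x) / (1 + \<bar>x\<bar>)))"
    proof (rule AE_I2)
      fix x :: real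
      have "(1 + \<bar>x\<bar>) * norm (\<phi> x) \<le> (2 + \<bar>x\<bar>) * norm (\<phi> x)" by (intro mult_right_mono) auto
      also have "\<dots> \<le> \<bar>C\<bar> * (1 + \<bar>x\<bar>) powr (-2)" using C[of x] abs_ge_self[of C]
        by (smt (verit) mult_right_mono powr_ge_zero)
      also have "\<dots> \<le> \<bar>C\<bar> * 1" 
      proof (intro mult_left_mono)
        have "(1 + \<bar>x\<bar>) powr (-2) \<le> (1 + \<bar>x\<bar>) powr 0" by (rule powr_mono) auto
        also have "\<dots> = 1" using one_plus_abs_pos[of x] by (simp only: powr_zero_eq_one) simp
        finally show "(1 + \<bar>x\<bar>) powr (-2) \<le> 1" .
      qed simp
      finally have "norm (\<phi> x) \<le> \<bar>C\<bar> / (1 + \<bar>x\<bar>)" using one_plus_abs_pos[of x]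
        by (simp add: le_divide_eq mult.commute)
      then have "norm (h x) * norm (\<phi> x) \<le> norm (h x) * (\<bar>C\<bar> / (1 + \<bar>x\<bar>))" by (intro mult_left_mono) auto
      then show "norm (h x * \<phi> x) \<le> norm (\<bar>C\<bar> * (norm (h x) / (1 + \<bar>x\<bar>)))"
        using one_plus_abs_pos[of x] by (simp add: norm_mult mult.commute)
    qed
  qed measurable
qed

text \<open>Here the normal densities are themselves the test functions; in
  \<open>fourier_inj\<close> they arise as transforms of test functions.\<close>

lemma regular_dist_inj:
  assumes "tame g" "tame h" "regular_dist g = regular_dist h"
  shows "AE x in lebesgue. g x = h x"
proof -
  have "AE x in lebesgue. g x - h x = 0"
  proof (rule tame_AE_eq_0[OF tame_diff[OF assms(1,2)]])
    fix a \<sigma> :: real assume s: "\<sigma> > 0"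
    let ?n = "\<lambda>t. of_real (normal_density a \<sigma> t) :: complex"
    have n: "?n \<in> Schwartz" by (rule normal_density_Schwartz[OF s])
    have "(LINT t|lebesgue. (g t - h t) * ?n t) = regular_dist g ?n - regular_dist h ?n"
      unfolding regular_dist_def using n
      by (simp add: left_diff_distrib integrable_tame_mult_Schwartz[OF assms(1) n] integrable_tame_mult_Schwartz[OF assms(2) n])
    then show "(LINT t|lebesgue. (g t - h t) * ?n t) = 0" by (simp add: assms(3))
  qed
  then show ?thesis by auto
qed

section \<open>Absolute continuity\<close>

text \<open>The inner condition of \<open>abs_cont\<close> for one interval and one pair, cut out so
  that the \<delta> belonging to a given \<epsilon> can be handed from lemma to lemma.\<close>

definition ac_modulus :: "real \<Rightarrow> real \<Rightarrow> (real \<Rightarrow> complex) \<Rightarrow> real \<Rightarrow> real \<Rightarrow> bool" where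
  "ac_modulus a b f \<epsilon> \<delta> \<longleftrightarrow> (\<forall>(m::nat) (x::nat \<Rightarrow> real) (y::nat \<Rightarrow> real).
     (\<forall>i<m. a \<le> x i \<and> x i \<le> y i \<and> y i \<le> b) \<longrightarrow>
     disjoint_family_on (\<lambda>i. {x i<..<y i}) {..<m} \<longrightarrow>
     (\<Sum>i<m. y i - x i) < \<delta> \<longrightarrow> (\<Sum>i<m. norm (f (y i) - f (x i))) < \<epsilon>)"

text \<open>Tied to a single interval because products with a smooth function are controlled by
  bounds that depend on the interval.\<close>

definition abs_cont_on :: "real \<Rightarrow> real \<Rightarrow> (real \<Rightarrow> complex) \<Rightarrow> bool" where
  "abs_cont_on a b f \<longleftrightarrow> (\<forall>\<epsilon>>0. \<exists>\<delta>>0. ac_modulus a b f \<epsilon> \<delta>)"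

lemma abs_cont_on: "abs_cont f \<Longrightarrow> abs_cont_on a b f"
  by (simp add: abs_cont_def abs_cont_on_def ac_modulus_def)

lemma abs_cont_onD:
  assumes "abs_cont_on a b f" "0 < \<epsilon>"
  obtains \<delta> where "0 < \<delta>" "ac_modulus a b f \<epsilon> \<delta>"
  using assms unfolding abs_cont_on_def by blast

lemma ac_modulusD:
  fixes m :: nat
  assumes "ac_modulus a b f \<epsilon> \<delta>" "\<And>i. i < m \<Longrightarrow> a \<le> x i \<and> x i \<le> y i \<and> y i \<le> b"
    "disjoint_family_on (\<lambda>i. {x i<..<y i}) {..<m}" "(\<Sum>i<m. y i - x i) < \<delta>"
  shows "(\<Sum>i<m. norm (f (y i) - f (x i))) < \<epsilon>"
  using assms unfolding ac_modulus_def by blast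

lemma abs_cont_imp_continuous:
  assumes "abs_cont f"
  shows "continuous_on A f"
proof (rule continuous_at_imp_continuous_on, rule ballI)
  fix t
  show "isCont f t"
    unfolding continuous_at_eps_delta
  proof (intro allI impI)
    fix e :: real assume "e > 0"
    then obtain \<delta> where d: "0 < \<delta>" "ac_modulus (t - 1) (t + 1) f e \<delta>"
      using abs_cont_onD[OF abs_cont_on[OF assms]] by blast
    \<comment> \<open>Families consisting of a single interval already give continuity.\<close>
    have "norm (f v - f u) < e" if "t - 1 \<le> u" "u \<le> v" "v \<le> t + 1" "v - u < \<delta>" for u v
      using ac_modulusD[OF d(2), of "Suc 0" "\<lambda>_. u" "\<lambda>_. v"] that by (simp add: disjoint_family_on_def)
    then have *: "dist (f v) (f u) < e" if "t - 1 \<le> u" "u \<le> v" "v \<le> t + 1" "v - u < \<delta>" for u v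
      using that by (simp add: dist_norm)
    have "dist (f s) (f t) < e" if "dist s t < min 1 \<delta>" for s
    proof (cases "s \<le> t")
      case True
      with that show ?thesis by (subst dist_commute, intro *) (auto simp: dist_real_def)
    next
      case False
      with that show ?thesis by (intro *) (auto simp: dist_real_def)
    qed
    then show "\<exists>d>0. \<forall>x'. dist x' t < d \<longrightarrow> dist (f x') (f t) < e"
      using d(1) by (intro exI[of _ "min 1 \<delta>"]) auto
  qed
qed

text \<open>Tags in the exceptional null set contribute little because their intervals lie in an open
  superset of small measure; the other tags are handled by differentiability.\<close>

lemma has_integral_abs_cont_on:
  fixes f g :: "real \<Rightarrow> complex"
  assumes ab: "a \<le> b" and ac: "abs_cont_on a b f" and N: "negligible N"
    and f': "\<And>t. t \<in> {a..b} - N \<Longrightarrow> (f has_vector_derivative g t) (at t within {a..b})"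
  shows "(g has_integral (f b - f a)) {a..b}"
proof -
  \<comment> \<open>With the integrand set to 0 on N, a tag in N leaves only the increment of f,
    which absolute continuity controls.\<close>
  define h where "h t = (if t \<in> N then 0 else g t)" for t
  have "(h has_integral (f b - f a)) {a..b}"
    unfolding has_integral_real
  proof (intro allI impI)
    fix e :: real assume e: "e > 0"
    obtain \<delta> where \<delta>: "0 < \<delta>" and d: "ac_modulus a b f (e / 2) \<delta>"
      using abs_cont_onD[OF ac, of "e / 2"] e by auto
    have Nnull: "N \<in> null_sets lebesgue" using N by (simp add: negligible_iff_null_sets)
    \<comment> \<open>Outer regularity: an open superset of the null set, of measure below the
      \<delta> of absolute continuity.\<close>
    obtain U where U: "open U" "N \<subseteq> U" "emeasure lebesgue (U - N) < ennreal \<delta>"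
      using sets_lebesgue_outer_open[of N \<delta>] Nnull \<delta> by blast
    have eU: "emeasure lborel U < ennreal \<delta>"
    proof -
      have "emeasure lebesgue (U - N) = emeasure lebesgue U"
        using Nnull U(1) by (intro emeasure_Diff_null_set) auto
      with U show ?thesis by (simp add: emeasure_completion)
    qed
    \<comment> \<open>The good tags then cost at most \<eta>(b - a) <= e/4, below the e/2 reserved
      for them; the added 1 covers a = b.\<close>
    define \<eta> where "\<eta> = e / (4 * (b - a + 1))"
    have \<eta>: "\<eta> > 0" using e ab by (simp add: \<eta>_def)
    have "\<exists>r>0. (t \<in> N \<longrightarrow> ball t r \<subseteq> U) \<and>
        (t \<in> {a..b} - N \<longrightarrow> (\<forall>s\<in>{a..b}. \<bar>s - t\<bar> < r \<longrightarrow> norm (f s - f t - (s - t) *\<^sub>R g t) \<le> \<eta> * \<bar>s - t\<bar>))" for t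
    proof (cases "t \<in> N")
      case True
      with U show ?thesis by (meson DiffD2 openE subsetD)
    next
      case False
      show ?thesis
      proof (cases "t \<in> {a..b}")
        case True
        with f'[of t] False have "(f has_derivative (\<lambda>x. x *\<^sub>R g t)) (at t within {a..b})"
          by (simp add: has_vector_derivative_def)
        then obtain r where "r > 0" "\<forall>s\<in>{a..b}. norm (s - t) < r \<longrightarrow> norm (f s - f t - (s - t) *\<^sub>R g t) \<le> \<eta> * norm (s - t)"
          unfolding has_derivative_within_alt using \<eta> by blast
        with False show ?thesis by (intro exI[of _ r]) auto
      qed (use False in \<open>auto intro: exI[of _ 1]\<close>)
    qed
    then have "\<forall>t. \<exists>r>0. (t \<in> N \<longrightarrow> ball t r \<subseteq> U) \<and>
        (t \<in> {a..b} - N \<longrightarrow> (\<forall>s\<in>{a..b}. \<bar>s - t\<bar> < r \<longrightarrow> norm (f s - f t - (s - t) *\<^sub>R g t) \<le> \<eta> * \<bar>s - t\<bar>))" ..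
    from choice[OF this] obtain r where r: "\<forall>t. 0 < r t \<and> (t \<in> N \<longrightarrow> ball t (r t) \<subseteq> U) \<and>
        (t \<in> {a..b} - N \<longrightarrow> (\<forall>s\<in>{a..b}. \<bar>s - t\<bar> < r t \<longrightarrow> norm (f s - f t - (s - t) *\<^sub>R g t) \<le> \<eta> * \<bar>s - t\<bar>))" ..
    have r0: "r t > 0" and rN: "t \<in> N \<Longrightarrow> ball t (r t) \<subseteq> U" for t
      using r by auto
    have rD: "norm (f s - f t - (s - t) *\<^sub>R g t) \<le> \<eta> * \<bar>s - t\<bar>"
      if "t \<in> {a..b} - N" "s \<in> {a..b}" "\<bar>s - t\<bar> < r t" for t s
      using r that by blast
    have "norm ((\<Sum>(x,k)\<in>p. measure lborel k *\<^sub>R h x) - (f b - f a)) < e"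
      if p: "p tagged_division_of {a..b}" and fine: "(\<lambda>t. ball t (r t)) fine p" for p
    proof -
      note pD = tagged_division_ofD[OF p]
      define D where "D = (\<lambda>(x::real, k). measure lborel k *\<^sub>R h x - (f (Sup k) - f (Inf k)))"
      have k: "\<exists>u v. k = {u..v} \<and> u \<le> v \<and> a \<le> u \<and> v \<le> b \<and> Inf k = u \<and> Sup k = v \<and> u \<le> x \<and> x \<le> v
          \<and> {u..v} \<subseteq> ball x (r x)" if xk: "(x, k) \<in> p" for x k
      proof -
        obtain u v where uv: "k = {u..v}" using pD(4)[OF xk] by auto
        moreover have "u \<le> x" "x \<le> v" using pD(2)[OF xk] uv by auto
        moreover have "a \<le> u" "v \<le> b" using pD(3)[OF xk] uv calculation by auto
        moreover have "k \<subseteq> ball x (r x)" using fine xk by (auto simp: fine_def)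
        ultimately show ?thesis by auto
      qed
      have "(\<Sum>(x,k)\<in>p. f (Sup k) - f (Inf k)) = f b - f a"
        by (rule additive_tagged_division_1[OF ab p])
      then have "(\<Sum>(x,k)\<in>p. measure lborel k *\<^sub>R h x) - (f b - f a) = (\<Sum>xk\<in>p. D xk)"
        by (simp add: D_def sum_subtractf case_prod_unfold)
      also have "\<dots> = (\<Sum>xk\<in>{xk\<in>p. fst xk \<notin> N}. D xk) + (\<Sum>xk\<in>{xk\<in>p. fst xk \<in> N}. D xk)"
        using pD(1) by (subst sum.union_disjoint[symmetric]) (auto intro!: sum.cong)
      finally have split: "norm ((\<Sum>(x,k)\<in>p. measure lborel k *\<^sub>R h x) - (f b - f a)) \<le>
          norm (\<Sum>xk\<in>{xk\<in>p. fst xk \<notin> N}. D xk) + norm (\<Sum>xk\<in>{xk\<in>p. fst xk \<in> N}. D xk)"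
        by (simp add: norm_triangle_ineq)
      have "norm (\<Sum>xk\<in>{xk\<in>p. fst xk \<notin> N}. D xk) \<le> (\<Sum>xk\<in>{xk\<in>p. fst xk \<notin> N}. \<eta> * (Sup (snd xk) - Inf (snd xk)))"
      proof (rule sum_norm_le, clarify)
        fix x k assume xk: "(x, k) \<in> p" "fst (x, k) \<notin> N"
        obtain u v where uv: "k = {u..v}" "u \<le> v" "a \<le> u" "v \<le> b" "Inf k = u" "Sup k = v" "u \<le> x" "x \<le> v"
          "{u..v} \<subseteq> ball x (r x)" using k[OF xk(1)] by blast
        have xN: "x \<in> {a..b} - N" using xk uv by auto
        have "u \<in> {u..v}" "v \<in> {u..v}" using uv(2) by auto
        then have "u \<in> ball x (r x)" "v \<in> ball x (r x)" using uv(9) by blast+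
        then have "\<bar>u - x\<bar> < r x" "\<bar>v - x\<bar> < r x" by (auto simp: dist_real_def abs_minus_commute)
        then have 1: "norm (f u - f x - (u - x) *\<^sub>R g x) \<le> \<eta> * \<bar>u - x\<bar>"
          "norm (f v - f x - (v - x) *\<^sub>R g x) \<le> \<eta> * \<bar>v - x\<bar>"
          using uv(2,3,4) rD[OF xN, of u] rD[OF xN, of v] by auto
        have "D (x, k) = (v - u) *\<^sub>R g x - (f v - f u)"
          using xN uv(2) unfolding D_def h_def prod.case uv(5,6) by (simp add: uv(1))
        \<comment> \<open>The straddle argument: both endpoints are compared with the tag, and |u -
          x| + |v - x| = v - u because the tag lies between them.\<close>
        also have "\<dots> = (f u - f x - (u - x) *\<^sub>R g x) - (f v - f x - (v - x) *\<^sub>R g x)"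
          by (simp add: algebra_simps)
        finally have "norm (D (x, k)) \<le> norm (f u - f x - (u - x) *\<^sub>R g x) + norm (f v - f x - (v - x) *\<^sub>R g x)"
          by (simp only: norm_triangle_ineq4)
        also have "\<dots> \<le> \<eta> * \<bar>u - x\<bar> + \<eta> * \<bar>v - x\<bar>" using 1 by (rule add_mono)
        also have "\<dots> = \<eta> * (v - u)" using uv(7,8) by (simp add: algebra_simps)
        finally show "norm (D (x, k)) \<le> \<eta> * (Sup (snd (x, k)) - Inf (snd (x, k)))" by (simp only: snd_conv uv(5,6))
      qed
      also have "\<dots> \<le> (\<Sum>xk\<in>p. \<eta> * (Sup (snd xk) - Inf (snd xk)))"
      proof (rule sum_mono2)
        fix xk assume "xk \<in> p - {xk\<in>p. fst xk \<notin> N}"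
        then have "Inf (snd xk) \<le> Sup (snd xk)" using k[of "fst xk" "snd xk"] by fastforce
        then show "0 \<le> \<eta> * (Sup (snd xk) - Inf (snd xk))" using \<eta> by simp
      qed (use pD(1) in auto)
      also have "\<dots> = \<eta> * (b - a)"
        using additive_tagged_division_1[OF ab p, of "\<lambda>x. x"]
        by (simp add: sum_distrib_left[symmetric] case_prod_unfold)
      also have "\<dots> < e / 2"
      proof -
        have "(b - a) / (b - a + 1) < 1" using ab by simp
        then have "e / 4 * ((b - a) / (b - a + 1)) \<le> e / 4 * 1" using e by (intro mult_left_mono) auto
        moreover have "\<eta> * (b - a) = e / 4 * ((b - a) / (b - a + 1))" by (simp add: \<eta>_def)
        ultimately show ?thesis using e by linarith
      qed
      finally have A: "norm (\<Sum>xk\<in>{xk\<in>p. fst xk \<notin> N}. D xk) < e / 2" .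
      define P where "P = {xk\<in>p. fst xk \<in> N}"
      have "finite P" using pD(1) by (simp add: P_def)
      \<comment> \<open>Absolute continuity speaks of families indexed by naturals, so the finite
        set of bad pairs is enumerated.\<close>
      then obtain q where q: "bij_betw q {..<card P} P"
        using ex_bij_betw_nat_finite[OF \<open>finite P\<close>] unfolding lessThan_atLeast0 by blast
      define X Y where "X i = Inf (snd (q i))" and "Y i = Sup (snd (q i))" for i
      have qk: "X i \<le> Y i \<and> a \<le> X i \<and> Y i \<le> b \<and> {X i<..<Y i} \<subseteq> U \<and> snd (q i) = {X i..Y i}" if "i < card P" for i
      proof -
        obtain x k where xk: "q i = (x, k)" by fastforce
        have "q i \<in> P" using q that by (auto simp: bij_betw_def)
        then have "(x, k) \<in> p" "x \<in> N" by (auto simp: xk P_def)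
        from k[OF this(1)] obtain u v where uv: "k = {u..v}" "u \<le> v" "a \<le> u" "v \<le> b" "Inf k = u" "Sup k = v"
          "{u..v} \<subseteq> ball x (r x)" by blast
        have "{u<..<v} \<subseteq> U" using uv(7) rN[OF \<open>x \<in> N\<close>] greaterThanLessThan_subseteq_atLeastAtMost_iff[of u v u v] by blast
        with uv show ?thesis by (simp add: X_def Y_def xk)
      qed
      have disj: "disjoint_family_on (\<lambda>i. {X i<..<Y i}) {..<card P}"
        unfolding disjoint_family_on_def
      proof (intro ballI impI)
        fix i j assume ij: "i \<in> {..<card P}" "j \<in> {..<card P}" "i \<noteq> j"
        then have "q i \<in> p" "q j \<in> p" "q i \<noteq> q j" using q by (auto simp: bij_betw_def inj_on_def P_def)
        then have "interior (snd (q i)) \<inter> interior (snd (q j)) = {}" using pD(5) by (metis prod.collapse)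
        then show "{X i<..<Y i} \<inter> {X j<..<Y j} = {}" using qk ij by (simp add: interior_atLeastAtMost_real)
      qed
      \<comment> \<open>The open intervals are disjoint and lie in U, so their total length is at
        most its measure, hence below \<delta>.\<close>
      have "ennreal (\<Sum>i<card P. Y i - X i) = (\<Sum>i<card P. ennreal (Y i - X i))"
        by (rule sum_ennreal[symmetric]) (use qk in auto)
      also have "\<dots> = (\<Sum>i<card P. emeasure lborel {X i<..<Y i})"
        by (intro sum.cong refl) (use qk in auto)
      also have "\<dots> = emeasure lborel (\<Union>i<card P. {X i<..<Y i})"
        using disj by (intro sum_emeasure) auto
      also have "\<dots> \<le> emeasure lborel U" 
      proof (rule emeasure_mono)
        show "(\<Union>i<card P. {X i<..<Y i}) \<subseteq> U" using qk by blast
      qed (use U(1) in auto)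
      also note eU
      finally have "(\<Sum>i<card P. Y i - X i) < \<delta>" 
        by (subst (asm) ennreal_less_iff) (auto intro!: sum_nonneg dest: qk)
      then have "(\<Sum>i<card P. norm (f (Y i) - f (X i))) < e / 2"
        by (intro ac_modulusD[OF d] disj) (auto dest: qk)
      moreover have "(\<Sum>i<card P. norm (f (Y i) - f (X i))) = (\<Sum>xk\<in>P. norm (f (Sup (snd xk)) - f (Inf (snd xk))))"
        using sum.reindex_bij_betw[OF q, of "\<lambda>xk. norm (f (Sup (snd xk)) - f (Inf (snd xk)))"] by (simp add: X_def Y_def)
      moreover have "norm (\<Sum>xk\<in>P. D xk) \<le> (\<Sum>xk\<in>P. norm (f (Sup (snd xk)) - f (Inf (snd xk))))"
        by (rule sum_norm_le) (auto simp: P_def D_def h_def norm_minus_commute)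
      ultimately have "norm (\<Sum>xk\<in>P. D xk) < e / 2" by linarith
      with A split show ?thesis by (simp add: P_def)
    qed
    moreover have "gauge (\<lambda>t. ball t (r t))" using r0 by (intro gauge_ball_dependent) auto
    ultimately show "\<exists>\<gamma>. gauge \<gamma> \<and> (\<forall>\<D>. \<D> tagged_division_of {a..b} \<and> \<gamma> fine \<D> \<longrightarrow>
        norm ((\<Sum>(x,k)\<in>\<D>. measure lborel k *\<^sub>R h x) - (f b - f a)) < e)"
      by (intro exI[of _ "\<lambda>t. ball t (r t)"]) simp
  qed
  then show ?thesis by (rule has_integral_spike[OF N, rotated]) (simp add: h_def)
qed

section \<open>Integration by parts with an absolutely continuous factor\<close>

lemma abs_cont_on_mult:
  assumes f: "abs_cont_on a b f" and bf: "\<And>t. t \<in> {a..b} \<Longrightarrow> norm (f t) \<le> M"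
    and bh: "\<And>t. t \<in> {a..b} \<Longrightarrow> norm (h t) \<le> B"
    and L: "\<And>u v. a \<le> u \<Longrightarrow> u \<le> v \<Longrightarrow> v \<le> b \<Longrightarrow> norm (h v - h u) \<le> L * (v - u)"
    and nn: "0 \<le> M" "0 \<le> B" "0 \<le> L"
  shows "abs_cont_on a b (\<lambda>t. h t * f t)"
  unfolding abs_cont_on_def ac_modulus_def
proof (intro allI impI)
  fix e :: real assume e: "e > 0"
  \<comment> \<open>Each term of the product rule for increments gets e/2: B multiplies the
    oscillation of f, and L M the total length. Adding 1 keeps the denominators positive.\<close>
  then have "e / (2 * (B + 1)) > 0" using nn by simp
  then obtain \<delta> where \<delta>: "0 < \<delta>" and d: "ac_modulus a b f (e / (2 * (B + 1))) \<delta>"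
    using abs_cont_onD[OF f] by blast
  define \<kappa> where "\<kappa> = min \<delta> (e / (2 * (L * M + 1)))"
  have \<kappa>: "\<kappa> > 0" using \<delta> e nn by (simp add: \<kappa>_def add_nonneg_pos)
  have "(\<Sum>i<m. norm (h (y i) * f (y i) - h (x i) * f (x i))) < e"
    if xy: "\<forall>i<m. a \<le> x i \<and> x i \<le> y i \<and> y i \<le> b" and dis: "disjoint_family_on (\<lambda>i. {x i<..<y i}) {..<m}"
      and sm: "(\<Sum>i<m. y i - x i) < \<kappa>" for m :: nat and x y
  proof -
    have "(\<Sum>i<m. norm (h (y i) * f (y i) - h (x i) * f (x i))) \<le> (\<Sum>i<m. B * norm (f (y i) - f (x i)) + L * M * (y i - x i))"
    proof (rule sum_mono)
      fix i assume "i \<in> {..<m}"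
      with xy have i: "a \<le> x i" "x i \<le> y i" "y i \<le> b" by auto
      have "norm (h (y i) * f (y i) - h (x i) * f (x i)) = norm (h (y i) * (f (y i) - f (x i)) + (h (y i) - h (x i)) * f (x i))"
        by (simp add: algebra_simps)
      also have "\<dots> \<le> norm (h (y i)) * norm (f (y i) - f (x i)) + norm (h (y i) - h (x i)) * norm (f (x i))"
        by (metis norm_mult norm_triangle_ineq)
      also have "\<dots> \<le> B * norm (f (y i) - f (x i)) + L * (y i - x i) * M"
        using i nn by (intro add_mono mult_mono bf bh L) auto
      finally show "norm (h (y i) * f (y i) - h (x i) * f (x i)) \<le> B * norm (f (y i) - f (x i)) + L * M * (y i - x i)"
        by (simp add: mult_ac)
    qed
    also have "\<dots> = B * (\<Sum>i<m. norm (f (y i) - f (x i))) + L * M * (\<Sum>i<m. y i - x i)"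
      by (simp add: sum.distrib sum_distrib_left)
    also have "\<dots> < e / 2 + e / 2"
    proof (rule add_le_less_mono)
      have "(\<Sum>i<m. norm (f (y i) - f (x i))) < e / (2 * (B + 1))"
        using xy dis sm by (intro ac_modulusD[OF d]) (auto simp: \<kappa>_def)
      then have "B * (\<Sum>i<m. norm (f (y i) - f (x i))) \<le> B * (e / (2 * (B + 1)))" using nn by (intro mult_left_mono) auto
      also have "\<dots> \<le> e / 2" using nn e by (simp add: field_simps)
      finally show "B * (\<Sum>i<m. norm (f (y i) - f (x i))) \<le> e / 2" .
      have "L * M * (\<Sum>i<m. y i - x i) \<le> L * M * (e / (2 * (L * M + 1)))"
        using nn sm by (intro mult_left_mono) (auto simp: \<kappa>_def)
      also have "\<dots> < e / 2"
      proof -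
        have "L * M / (L * M + 1) < 1" using nn by (simp add: add_nonneg_pos)
        then have "e / 2 * (L * M / (L * M + 1)) < e / 2 * 1" using e by (intro mult_strict_left_mono) auto
        then show ?thesis by (simp add: mult_ac)
      qed
      finally show "L * M * (\<Sum>i<m. y i - x i) < e / 2" .
    qed
    finally show ?thesis by simp
  qed
  with \<kappa> show "\<exists>\<delta>>0. \<forall>(m::nat) (x::nat \<Rightarrow> real) (y::nat \<Rightarrow> real).
     (\<forall>i<m. a \<le> x i \<and> x i \<le> y i \<and> y i \<le> b) \<longrightarrow>
     disjoint_family_on (\<lambda>i. {x i<..<y i}) {..<m} \<longrightarrow>
     (\<Sum>i<m. y i - x i) < \<delta> \<longrightarrow> (\<Sum>i<m. norm (h (y i) * f (y i) - h (x i) * f (x i))) < e" by blast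
qed

text \<open>Since h is continuously differentiable, it is Lipschitz on [a, b]. Then h f is
  absolutely continuous there, and its a.e. derivative, given by the product rule, integrates back
  to it.\<close>

lemma integration_by_parts_abs_cont:
  fixes f g h h' :: "real \<Rightarrow> complex"
  assumes ab: "a \<le> b" and f: "abs_cont f" and f': "AE t in lebesgue. (f has_vector_derivative g t) (at t)"
    and h: "\<And>t. (h has_vector_derivative h' t) (at t)" and h': "continuous_on UNIV h'"
  shows "((\<lambda>t. h t * g t + h' t * f t) has_integral (h b * f b - h a * f a)) {a..b}"
proof -
  obtain N where N: "N \<in> null_sets lebesgue" "{t \<in> space lebesgue. \<not> (f has_vector_derivative g t) (at t)} \<subseteq> N"
    using f' unfolding eventually_ae_filter by blast
  have cf: "continuous_on {a..b} f" using f by (rule abs_cont_imp_continuous)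
  have ch: "continuous_on {a..b} h" using h
    by (meson continuous_at_imp_continuous_on has_vector_derivative_continuous)
  have bdd: "\<exists>C\<ge>0. \<forall>t\<in>{a..b}. norm (k t) \<le> C" if k: "continuous_on {a..b} k" for k :: "real \<Rightarrow> complex"
  proof -
    obtain C where "0 < C" "\<forall>x\<in>k ` {a..b}. norm x \<le> C"
      using compact_imp_bounded[OF compact_continuous_image[OF k compact_Icc]] unfolding bounded_pos by blast
    then show ?thesis by (intro exI[of _ C]) auto
  qed
  obtain M where M: "M \<ge> 0" "\<And>t. t \<in> {a..b} \<Longrightarrow> norm (f t) \<le> M" using bdd[OF cf] by blast
  obtain B where B: "B \<ge> 0" "\<And>t. t \<in> {a..b} \<Longrightarrow> norm (h t) \<le> B" using bdd[OF ch] by blast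
  obtain L where L: "L \<ge> 0" "\<And>t. t \<in> {a..b} \<Longrightarrow> norm (h' t) \<le> L"
    using bdd[OF continuous_on_subset[OF h' subset_UNIV]] by blast
  have lip: "norm (h v - h u) \<le> L * (v - u)" if uv: "a \<le> u" "u \<le> v" "v \<le> b" for u v
  proof -
    have "norm (h v - h u) \<le> L * norm (v - u)"
    proof (rule differentiable_bound[where S = "{a..b}" and f' = "\<lambda>t x. x *\<^sub>R h' t"])
      show "(h has_derivative (\<lambda>x. x *\<^sub>R h' t)) (at t within {a..b})" for t
        using h[of t] unfolding has_vector_derivative_def by (rule has_derivative_at_withinI)
      show "onorm (\<lambda>x. x *\<^sub>R h' t) \<le> L" if "t \<in> {a..b}" for t
        using L(1) L(2)[OF that] by (intro onorm_bound) (simp_all add: mult.commute[of L] mult_left_mono)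
    qed (use uv in auto)
    with uv show ?thesis by simp
  qed
  have "abs_cont_on a b (\<lambda>t. h t * f t)"
    by (rule abs_cont_on_mult[OF abs_cont_on[OF f] M(2) B(2) lip M(1) B(1) L(1)])
  then show ?thesis
  proof (rule has_integral_abs_cont_on[OF ab])
    show "negligible N" using N by (simp add: negligible_iff_null_sets)
    fix t assume "t \<in> {a..b} - N"
    then have "(f has_vector_derivative g t) (at t)" using N by auto
    from has_vector_derivative_mult[OF h this]
    show "((\<lambda>t. h t * f t) has_vector_derivative h t * g t + h' t * f t) (at t within {a..b})"
      by (rule has_vector_derivative_at_within)
  qed
qed

section \<open>Derivatives of the kernel and integration by parts\<close>

text \<open>\<open>u_fun s t\<close> equals s times this function at ist. Being entire, it supplies
  all t-derivatives of the kernel, including those at t = 0.\<close>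

definition exp_quotient :: "complex \<Rightarrow> complex" where
  "exp_quotient z = (if z = 0 then 1 else (1 - exp (- z)) / z)"

text \<open>A removable singularity: the value 1 at 0 is the derivative of the numerator
  there.\<close>

lemma holomorphic_exp_quotient: "exp_quotient holomorphic_on UNIV"
proof -
  have "((\<lambda>z::complex. 1 - exp (- z)) has_field_derivative 1) (at 0)"
    by (auto intro!: derivative_eq_intros)
  then have d: "deriv (\<lambda>z::complex. 1 - exp (- z)) 0 = 1" by (rule DERIV_imp_deriv)
  show ?thesis
  proof (rule pole_theorem_0)
    show "(\<lambda>z::complex. 1 - exp (- z)) holomorphic_on UNIV" by (intro holomorphic_intros)
    show "exp_quotient 0 = deriv (\<lambda>z::complex. 1 - exp (- z)) 0" by (simp add: d exp_quotient_def)
  qed (auto simp: exp_quotient_def)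
qed

text \<open>The smooth extension of \<^const>\<open>u_deriv_kernel\<close> across \<open>t = 0\<close>.\<close>

definition u_deriv :: "nat \<Rightarrow> real \<Rightarrow> real \<Rightarrow> complex" where
  "u_deriv n s t = (-1) ^ n * (of_real s * (\<i> * of_real s) ^ n * (deriv ^^ n) exp_quotient (\<i> * of_real s * of_real t))"

lemma u_deriv_0: "u_deriv 0 s t = u_fun s t"
  by (auto simp: u_deriv_def u_fun_def exp_quotient_def)

text \<open>The factor (-1)^n in \<open>u_deriv\<close> is chosen so that differentiation gives
  minus the next kernel; the signs of repeated integration by parts then cancel.\<close>

lemma u_deriv_has_vector_derivative:
  "(u_deriv n s has_vector_derivative - u_deriv (Suc n) s t) (at t)"
proof -
  let ?D = "(deriv ^^ n) exp_quotient"
  have "?D holomorphic_on UNIV"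
    by (intro holomorphic_higher_deriv holomorphic_exp_quotient) auto
  then have D: "(?D has_field_derivative deriv ?D z) (at z)" for z
    by (rule holomorphic_derivI) auto
  have "((\<lambda>z. ?D (\<i> * of_real s * z)) has_field_derivative deriv ?D (\<i> * of_real s * of_real t) * (\<i> * of_real s)) (at (of_real t))"
    by (rule DERIV_chain2[OF D]) (auto intro!: derivative_eq_intros)
  then have "((\<lambda>z. (-1) ^ n * (of_real s * (\<i> * of_real s) ^ n * ?D (\<i> * of_real s * z))) has_field_derivative
      (-1) ^ n * (of_real s * (\<i> * of_real s) ^ n * (deriv ?D (\<i> * of_real s * of_real t) * (\<i> * of_real s)))) (at (of_real t))"
    by (intro DERIV_cmult)
  from has_vector_derivative_real_field[OF this] show ?thesis
    by (simp add: u_deriv_def[abs_def] mult_ac)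
qed

lemma continuous_u_deriv: "continuous_on A (u_deriv n s)"
  by (intro continuous_at_imp_continuous_on ballI has_vector_derivative_continuous[OF u_deriv_has_vector_derivative])

text \<open>Differentiation drops the top term. The range \<open>k<n\<close> is empty for n = 0, as
  the derivative of the constant 1 requires.\<close>

lemma has_field_derivative_exp_partial_sum:
  "((\<lambda>w::complex. \<Sum>k=0..n. w ^ k / fact k) has_field_derivative (\<Sum>k<n. w ^ k / fact k)) (at w)"
proof (induction n)
  case (Suc n)
  have "((\<lambda>w::complex. w ^ Suc n / fact (Suc n)) has_field_derivative of_nat (Suc n) * w ^ n / fact (Suc n)) (at w)"
    using DERIV_cdivide[OF DERIV_power[OF DERIV_ident, of "Suc n" w UNIV], of "fact (Suc n)"] by simp
  moreover have "of_nat (Suc n) * w ^ n / fact (Suc n) = w ^ n / fact n"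
    by (subst fact_Suc) (simp del: of_nat_Suc)
  ultimately have "((\<lambda>w::complex. w ^ Suc n / fact (Suc n)) has_field_derivative w ^ n / fact n) (at w)" by simp
  from DERIV_add[OF Suc this] show ?case by simp
qed auto

text \<open>Differentiating exp(-w) times the partial sum leaves only -exp(-w) w^n/n!. This single
  term extends the sum from n to n + 1 once the derivative of the prefactor is factored out.\<close>

lemma u_deriv_kernel_has_vector_derivative:
  assumes "t \<noteq> 0"
  shows "(u_deriv_kernel n s has_vector_derivative - u_deriv_kernel (Suc n) s t) (at t)"
proof -
  let ?E = "\<lambda>n w. \<Sum>k=0..n. w ^ k / fact k :: complex"
  let ?G = "\<lambda>z. 1 - exp (- (\<i> * of_real s * z)) * ?E n (\<i> * of_real s * z)"
  define z :: complex where "z = of_real t"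
  define w where "w = \<i> * of_real s * z"
  have z: "z \<noteq> 0" using assms by (simp add: z_def)
  have E: "((\<lambda>z. ?E n (\<i> * of_real s * z)) has_field_derivative (\<Sum>k<n. w ^ k / fact k) * (\<i> * of_real s)) (at z)"
    unfolding w_def by (rule DERIV_chain2[OF has_field_derivative_exp_partial_sum]) (auto intro!: derivative_eq_intros)
  have X: "((\<lambda>z. exp (- (\<i> * of_real s * z))) has_field_derivative - (exp (- w) * (\<i> * of_real s))) (at z)"
    unfolding w_def by (auto intro!: derivative_eq_intros)
  have S: "?E n w = (\<Sum>k<n. w ^ k / fact k) + w ^ n / fact n"
    by (simp add: atLeast0AtMost lessThan_Suc_atMost[symmetric])
  have "(?G has_field_derivative - (- (exp (- w) * (\<i> * of_real s)) * ?E n w + (\<Sum>k<n. w ^ k / fact k) * (\<i> * of_real s) * exp (- w))) (at z)"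
    using DERIV_diff[OF DERIV_const DERIV_mult[OF X E], of 1] by (simp add: w_def)
  moreover have "- (- (exp (- w) * (\<i> * of_real s)) * ?E n w + (\<Sum>k<n. w ^ k / fact k) * (\<i> * of_real s) * exp (- w))
      = exp (- w) * (\<i> * of_real s) * (w ^ n / fact n)"
    unfolding S by (simp add: algebra_simps)
  ultimately have G: "(?G has_field_derivative exp (- w) * (\<i> * of_real s) * (w ^ n / fact n)) (at z)" by simp
  have I: "((\<lambda>z. fact n / (\<i> * z ^ (n + 1))) has_field_derivative - (of_nat (n + 1) * fact n / (\<i> * z ^ (n + 2)))) (at z)"
  proof -
    have "((\<lambda>z. \<i> * z ^ (n + 1)) has_field_derivative \<i> * (of_nat (n + 1) * z ^ n)) (at z)"
      using DERIV_cmult[OF DERIV_power[OF DERIV_ident, of "n + 1" z UNIV], of "\<i>"] by simp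
    from DERIV_divide[OF DERIV_const this, of "fact n"] z
    have "((\<lambda>z. fact n / (\<i> * z ^ (n + 1))) has_field_derivative
        (0 * (\<i> * z ^ (n + 1)) - fact n * (\<i> * (of_nat (n + 1) * z ^ n))) / ((\<i> * z ^ (n + 1)) * (\<i> * z ^ (n + 1)))) (at z)"
      by simp
    moreover have "(0 * (\<i> * z ^ (n + 1)) - fact n * (\<i> * (of_nat (n + 1) * z ^ n))) / ((\<i> * z ^ (n + 1)) * (\<i> * z ^ (n + 1)))
        = - (of_nat (n + 1) * fact n / (\<i> * z ^ (n + 2)))"
      using z by (simp add: divide_simps power2_eq_square)
    ultimately show ?thesis by simp
  qed
  have *: "- (of_nat (n + 1) * fact n / (\<i> * z ^ (n + 2))) * ?G z + exp (- w) * (\<i> * of_real s) * (w ^ n / fact n) * (fact n / (\<i> * z ^ (n + 1)))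
     = - (fact (Suc n) / (\<i> * z ^ (n + 2)) * (1 - exp (- w) * ?E (Suc n) w))"
  proof -
    have "exp (- w) * (\<i> * of_real s) * (w ^ n / fact n) * (fact n / (\<i> * z ^ (n + 1)))
       = fact (Suc n) / (\<i> * z ^ (n + 2)) * (exp (- w) * (w ^ Suc n / fact (Suc n)))"
      using z by (simp add: w_def divide_simps del: fact_Suc)
    moreover have "of_nat (n + 1) * fact n = (fact (Suc n) :: complex)" by simp
    moreover have "?E (Suc n) w = ?E n w + w ^ Suc n / fact (Suc n)" by simp
    moreover have "- A * (1 - e * S) + A * (e * T) = - (A * (1 - e * (S + T)))" for A e S T :: complex
      by (simp add: algebra_simps)
    ultimately show ?thesis by (simp only: w_def[symmetric])
  qed
  have "((\<lambda>z. fact n / (\<i> * z ^ (n + 1)) * ?G z) has_field_derivative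
     - (fact (Suc n) / (\<i> * z ^ (n + 2)) * (1 - exp (- w) * ?E (Suc n) w))) (at z)"
    using DERIV_mult[OF I G] unfolding *[symmetric] .
  from has_vector_derivative_real_field[OF this[unfolded z_def]] show ?thesis
    by (simp add: u_deriv_kernel_def[abs_def] w_def z_def del: fact_Suc)
qed

text \<open>Both families obey the same recursion under differentiation. Equality off 0 is equality
  on an open set and so passes to derivatives, which is the induction step.\<close>

lemma u_deriv_eq_kernel:
  assumes "t \<noteq> 0"
  shows "u_deriv n s t = u_deriv_kernel n s t"
  using assms
proof (induction n arbitrary: t)
  case 0
  then show ?case by (simp add: u_deriv_0 u_fun_def u_deriv_kernel_def)
next
  case (Suc n)
  have "(u_deriv n s has_vector_derivative - u_deriv_kernel (Suc n) s t) (at t)"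
    by (rule has_vector_derivative_transform_within_open[OF u_deriv_kernel_has_vector_derivative[OF Suc.prems], of "- {0}"])
       (use Suc in auto)
  from vector_derivative_unique_at[OF this u_deriv_has_vector_derivative] show ?case by simp
qed

text \<open>For |t| >= 1 the partial sum is O(|t|^n), so against the power n + 1 in the denominator
  one factor 1/t survives.\<close>

lemma u_deriv_kernel_bound:
  assumes "1 \<le> \<bar>t\<bar>"
  shows "norm (u_deriv_kernel n s t * of_real t) \<le> fact n * (1 + (\<Sum>k=0..n. \<bar>s\<bar> ^ k / fact k))"
proof -
  let ?S = "\<Sum>k=0..n. (\<i> * of_real s * of_real t) ^ k / fact k :: complex"
  have t: "t \<noteq> 0" using assms by auto
  have "norm ?S \<le> (\<Sum>k=0..n. \<bar>t\<bar> ^ n * (\<bar>s\<bar> ^ k / fact k))"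
  proof (rule sum_norm_le)
    fix k assume "k \<in> {0..n}"
    then have "\<bar>t\<bar> ^ k \<le> \<bar>t\<bar> ^ n" using assms by (intro power_increasing) auto
    then have "\<bar>t\<bar> ^ k * (\<bar>s\<bar> ^ k / fact k) \<le> \<bar>t\<bar> ^ n * (\<bar>s\<bar> ^ k / fact k)" by (intro mult_right_mono) auto
    then show "norm ((\<i> * of_real s * of_real t) ^ k / fact k :: complex) \<le> \<bar>t\<bar> ^ n * (\<bar>s\<bar> ^ k / fact k)"
      by (simp add: norm_divide norm_power norm_mult power_mult_distrib mult_ac)
  qed
  also have "\<dots> = \<bar>t\<bar> ^ n * (\<Sum>k=0..n. \<bar>s\<bar> ^ k / fact k)" by (simp add: sum_distrib_left)
  finally have S: "norm ?S \<le> \<bar>t\<bar> ^ n * (\<Sum>k=0..n. \<bar>s\<bar> ^ k / fact k)" .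
  have "norm (1 - exp (- (\<i> * of_real s * of_real t)) * ?S) \<le> 1 + norm ?S"
    by (rule order_trans[OF norm_triangle_ineq4]) (simp add: norm_mult norm_exp_eq_Re)
  also have "\<dots> \<le> \<bar>t\<bar> ^ n + \<bar>t\<bar> ^ n * (\<Sum>k=0..n. \<bar>s\<bar> ^ k / fact k)"
    using S assms by (intro add_mono) auto
  finally have "norm (1 - exp (- (\<i> * of_real s * of_real t)) * ?S) \<le> \<bar>t\<bar> ^ n * (1 + (\<Sum>k=0..n. \<bar>s\<bar> ^ k / fact k))"
    by (simp add: algebra_simps)
  then have "fact n / \<bar>t\<bar> ^ n * norm (1 - exp (- (\<i> * of_real s * of_real t)) * ?S) \<le>
      fact n / \<bar>t\<bar> ^ n * (\<bar>t\<bar> ^ n * (1 + (\<Sum>k=0..n. \<bar>s\<bar> ^ k / fact k)))"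
    by (intro mult_left_mono) auto
  then show ?thesis using t
    by (simp add: u_deriv_kernel_def norm_mult norm_divide norm_power)
qed

section \<open>Growth at infinity and n-fold integration by parts\<close>

lemma abs_cont_growth:
  assumes f: "abs_cont f" and f': "AE t in lebesgue. (f has_vector_derivative g t) (at t)" and g: "tame g"
  shows "((\<lambda>t. f t / of_real t) \<longlongrightarrow> 0) at_infinity"
proof -
  note [measurable] = g[THEN tame_measurable] measurable_ident_lebesgue
  have int: "integrable lebesgue (\<lambda>x. indicator {-r..r} x * norm (g x))" for r
  proof (rule Bochner_Integration.integrable_bound)
    show "integrable lebesgue (\<lambda>x. norm (g x) / (1 + \<bar>x\<bar>) * (1 + \<bar>r\<bar>))"
      using g by (intro integrable_mult_left) (simp add: tame_def)
    show "AE x in lebesgue. norm (indicator {-r..r} x * norm (g x)) \<le> norm (norm (g x) / (1 + \<bar>x\<bar>) * (1 + \<bar>r\<bar>))"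
    proof (rule AE_I2)
      fix x
      have "norm (g x) * (1 + \<bar>x\<bar>) \<le> norm (g x) * (1 + \<bar>r\<bar>)" if "-r \<le> x" "x \<le> r"
        using that by (intro mult_left_mono) auto
      then show "norm (indicator {-r..r} x * norm (g x)) \<le> norm (norm (g x) / (1 + \<bar>x\<bar>) * (1 + \<bar>r\<bar>))"
        using one_plus_abs_pos[of x] by (auto simp: indicator_def le_divide_eq abs_mult)
    qed
  qed measurable
  define G where "G r = (LINT x|lebesgue. indicator {-r..r} x * norm (g x))" for r
  have fG: "norm (f t - f 0) \<le> G \<bar>t\<bar>" for t
  proof -
    have *: "norm (f b - f a) \<le> G r" if ab: "a \<le> b" "-r \<le> a" "b \<le> r" for a b r
    proof -
      \<comment> \<open>The fundamental theorem of calculus, as integration by parts with h =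
        1.\<close>
      have "((\<lambda>t. 1 * g t + 0 * f t) has_integral 1 * f b - 1 * f a) {a..b}"
        by (rule integration_by_parts_abs_cont[OF ab(1) f f']) auto
      then have X: "((\<lambda>t. if t \<in> {a..b} then g t else 0) has_integral f b - f a) UNIV"
        by (subst has_integral_restrict_UNIV) simp
      have i: "integrable lebesgue (\<lambda>t. if t \<in> {a..b} then g t else 0)"
      proof (rule Bochner_Integration.integrable_bound[OF int[of r]])
        show "AE x in lebesgue. norm (if x \<in> {a..b} then g x else 0) \<le> norm (indicator {- r..r} x * norm (g x))"
          using ab by (intro AE_I2) (auto simp: indicator_def)
      qed measurable
      have "f b - f a = (LINT t|lebesgue. (if t \<in> {a..b} then g t else 0))"
        by (rule has_integral_unique[OF X has_integral_integral_lebesgue[OF i]])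
      also have "norm \<dots> \<le> (LINT t|lebesgue. norm (if t \<in> {a..b} then g t else 0))" by (rule integral_norm_bound)
      also have "\<dots> \<le> G r" unfolding G_def
        using ab by (intro integral_mono integrable_norm i int) (auto simp: indicator_def)
      finally show ?thesis .
    qed
    show ?thesis
    proof (cases "0 \<le> t")
      case True
      with *[of 0 t t] show ?thesis by simp
    next
      case False
      with *[of t 0 "-t"] show ?thesis by (simp add: norm_minus_commute)
    qed
  qed
  \<comment> \<open>Dominated convergence: for r >= 1 and |x| <= r one has 1 + |x| <= 2r, so
    |g(x)|/r is at most 2|g(x)|/(1 + |x|); for fixed x it tends to 0.\<close>
  have "((\<lambda>r. LINT x|lebesgue. indicator {-r..r} x * norm (g x) / r) \<longlongrightarrow> integral\<^sup>L lebesgue (\<lambda>x::real. 0::real)) at_top"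
  proof (rule integral_dominated_convergence_at_top)
    show "integrable lebesgue (\<lambda>x. 2 * (norm (g x) / (1 + \<bar>x\<bar>)))"
      using g by (intro integrable_mult_right) (simp add: tame_def)
    show "\<forall>\<^sub>F r in at_top. AE x in lebesgue. norm (indicator {-r..r} x * norm (g x) / r) \<le> 2 * (norm (g x) / (1 + \<bar>x\<bar>))"
      using eventually_ge_at_top[of 1]
    proof eventually_elim
      case (elim r)
      show ?case
      proof (rule AE_I2)
        fix x
        show "norm (indicator {-r..r} x * norm (g x) / r) \<le> 2 * (norm (g x) / (1 + \<bar>x\<bar>))"
        proof (cases "x \<in> {-r..r}")
          case True
          then have "1 + \<bar>x\<bar> \<le> 2 * r" using elim by auto
          then have "norm (g x) * (1 / r) \<le> norm (g x) * (2 / (1 + \<bar>x\<bar>))"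
            using elim one_plus_abs_pos[of x] by (intro mult_left_mono) (simp_all add: pos_divide_le_eq pos_le_divide_eq)
          then show ?thesis using True elim by (simp add: mult.commute)
        qed simp
      qed
    qed
    show "AE x in lebesgue. ((\<lambda>r. indicator {-r..r} x * norm (g x) / r) \<longlongrightarrow> 0) at_top"
    proof (rule AE_I2)
      fix x
      have "((\<lambda>r::real. norm (g x) / r) \<longlongrightarrow> 0) at_top"
        by (intro tendsto_divide_0[OF tendsto_const] filterlim_at_top_imp_at_infinity filterlim_ident)
      then show "((\<lambda>r. indicator {-r..r} x * norm (g x) / r) \<longlongrightarrow> 0) at_top"
      proof (rule Lim_null_comparison[rotated])
        show "\<forall>\<^sub>F r in at_top. norm (indicator {-r..r} x * norm (g x) / r) \<le> norm (g x) / r"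
          using eventually_gt_at_top[of 0] by eventually_elim (auto simp: indicator_def)
      qed
    qed
  qed measurable
  then have "((\<lambda>r. G r / r) \<longlongrightarrow> 0) at_top" by (simp add: G_def)
  moreover have "((\<lambda>r::real. norm (f 0) / r) \<longlongrightarrow> 0) at_top"
    by (intro tendsto_divide_0[OF tendsto_const] filterlim_at_top_imp_at_infinity filterlim_ident)
  ultimately have "((\<lambda>r. G r / r + norm (f 0) / r) \<longlongrightarrow> 0 + 0) at_top" by (rule tendsto_add)
  then have "((\<lambda>t::real. G (norm t) / norm t + norm (f 0) / norm t) \<longlongrightarrow> 0) at_infinity"
    by (intro filterlim_compose[OF _ filterlim_norm_at_top, of "\<lambda>r. G r / r + norm (f 0) / r"]) simp
  then show ?thesis
  proof (rule Lim_null_comparison[rotated], intro always_eventually allI)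
    fix t
    have "norm (f t) \<le> G \<bar>t\<bar> + norm (f 0)" using fG[of t] norm_triangle_ineq2[of "f t" "f 0"] by linarith
    then have "norm (f t) / \<bar>t\<bar> \<le> (G \<bar>t\<bar> + norm (f 0)) / \<bar>t\<bar>" by (intro divide_right_mono) auto
    then show "norm (f t / of_real t) \<le> G (norm t) / norm t + norm (f 0) / norm t"
      by (simp add: norm_divide add_divide_distrib)
  qed
qed

lemma has_integral_u_deriv_kernel:
  fixes F Fn :: "real \<Rightarrow> complex"
  assumes n: "n \<ge> 1" and diff: "\<And>k t. k < n - 1 \<Longrightarrow> (vderiv ^^ k) F differentiable (at t)"
    and ac: "abs_cont ((vderiv ^^ (n - 1)) F)"
    and Fn: "AE t in lebesgue. ((vderiv ^^ (n - 1)) F has_vector_derivative Fn t) (at t)" and tame: "tame Fn"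
    and gr: "\<And>k. k + 2 \<le> n \<Longrightarrow> ((\<lambda>t. (vderiv ^^ k) F t / of_real t) \<longlongrightarrow> 0) at_infinity"
  shows "((\<lambda>t. u_deriv_kernel n s t * F t) has_integral Psi Fn s) UNIV"
proof -
  obtain m where m: "n = Suc m" using n by (cases n) auto
  define D where "D k = (vderiv ^^ k) F" for k
  have D0: "D 0 = F" by (simp add: D_def)
  have D': "(D k has_vector_derivative D (Suc k) t) (at t)" if "k < m" for k t
    using diff[of k t] that m by (simp add: D_def vderiv_def[of "(vderiv ^^ k) F"] vector_derivative_works)
  have acD: "abs_cont (D m)" and Fn: "AE t in lebesgue. (D m has_vector_derivative Fn t) (at t)"
    using ac Fn m by (simp_all add: D_def)
  have Dt: "((\<lambda>t. D k t / of_real t) \<longlongrightarrow> 0) at_infinity" if "k \<le> m" for k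
  proof (cases "k = m")
    case True
    then show ?thesis using abs_cont_growth[OF acD Fn tame] by simp
  next
    case False
    then show ?thesis using that gr[of k] m by (simp add: D_def)
  qed
  \<comment> \<open>All boundary terms of the repeated integration by parts; with m = n - 1, the
    j-th pairs the j-th kernel with the derivative of F of order m - j.\<close>
  define W where "W t = (\<Sum>j\<le>m. u_deriv j s t * D (m - j) t)" for t
  have W0: "(W \<longlongrightarrow> 0) at_infinity"
    unfolding W_def
  proof (intro tendsto_null_sum)
    fix j assume "j \<in> {..m}"
    define C where "C = fact j * (1 + (\<Sum>k=0..j. \<bar>s\<bar> ^ k / fact k))"
    have "((\<lambda>t. of_real C * (D (m - j) t / of_real t)) \<longlongrightarrow> 0) at_infinity"
      by (intro tendsto_mult_right_zero Dt) auto
    then have "((\<lambda>t. norm (of_real C * (D (m - j) t / of_real t))) \<longlongrightarrow> 0) at_infinity"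
      by (rule tendsto_norm_zero)
    then show "((\<lambda>t. u_deriv j s t * D (m - j) t) \<longlongrightarrow> 0) at_infinity"
    proof (rule Lim_null_comparison[rotated])
      have "\<forall>\<^sub>F t::real in at_infinity. 1 \<le> norm t"
        by (auto simp: eventually_at_infinity)
      then show "\<forall>\<^sub>F t in at_infinity. norm (u_deriv j s t * D (m - j) t) \<le> norm (of_real C * (D (m - j) t / of_real t))"
      proof eventually_elim
        case (elim t)
        then have t: "t \<noteq> 0" by auto
        \<comment> \<open>One factor t moves over to the kernel: the kernel times t stays bounded,
          while the derivative of F over t tends to 0.\<close>
        have "u_deriv j s t * D (m - j) t = (u_deriv_kernel j s t * of_real t) * (D (m - j) t / of_real t)"
          using t by (simp add: u_deriv_eq_kernel)
        also have "norm \<dots> \<le> C * norm (D (m - j) t / of_real t)"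
          unfolding norm_mult[of "u_deriv_kernel j s t * of_real t"] C_def
          using elim by (intro mult_right_mono u_deriv_kernel_bound) auto
        also have "\<dots> \<le> norm (of_real C * (D (m - j) t / of_real t))"
          unfolding norm_mult norm_of_real by (intro mult_right_mono) auto
        finally show ?case .
      qed
    qed
  qed
  have parts: "((\<lambda>t. u_deriv n s t * F t) has_integral integral {a..b} (\<lambda>t. u_fun s t * Fn t) - (W b - W a)) {a..b}"
    if ab: "a \<le> b" for a b
  proof -
    \<comment> \<open>The term j = 0 is kept apart because it contains \<open>D m\<close>, whose
      derivative is given only almost everywhere. The other terms are differentiable everywhere, so
      the ordinary fundamental theorem applies to their sum.\<close>
    define W2 where "W2 t = (\<Sum>j=1..m. u_deriv j s t * D (m - j) t)" for t
    have W: "W t = u_deriv 0 s t * D m t + W2 t" for t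
    proof -
      have "{..m} = insert 0 {1..m}" by auto
      then show ?thesis unfolding W_def W2_def by simp
    qed
    have 1: "((\<lambda>t. u_deriv 0 s t * Fn t + - u_deriv (Suc 0) s t * D m t) has_integral
        (u_deriv 0 s b * D m b - u_deriv 0 s a * D m a)) {a..b}"
      by (rule integration_by_parts_abs_cont[OF ab acD Fn u_deriv_has_vector_derivative])
         (intro continuous_intros continuous_u_deriv)
    have W2': "(W2 has_vector_derivative u_deriv 1 s t * D m t - u_deriv (Suc m) s t * D 0 t) (at t)" for t
    proof -
      have "(W2 has_vector_derivative (\<Sum>j=1..m. u_deriv j s t * D (Suc m - j) t - u_deriv (Suc j) s t * D (Suc m - Suc j) t)) (at t)"
        unfolding W2_def
      proof (rule has_vector_derivative_sum)
        fix j assume j: "j \<in> {1..m}"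
        then have e: "Suc (m - j) = Suc m - j" by auto
        have "((\<lambda>t. u_deriv j s t * D (m - j) t) has_vector_derivative
          u_deriv j s t * D (Suc (m - j)) t + - u_deriv (Suc j) s t * D (m - j) t) (at t)"
          using j by (intro has_vector_derivative_mult u_deriv_has_vector_derivative D') auto
        then show "((\<lambda>t. u_deriv j s t * D (m - j) t) has_vector_derivative
          u_deriv j s t * D (Suc m - j) t - u_deriv (Suc j) s t * D (Suc m - Suc j) t) (at t)"
          unfolding e by simp
      qed
      \<comment> \<open>The telescoping leaves the link to the j = 0 step and the final
        integrand.\<close>
      also have "(\<Sum>j=1..m. u_deriv j s t * D (Suc m - j) t - u_deriv (Suc j) s t * D (Suc m - Suc j) t)
          = u_deriv 1 s t * D m t - u_deriv (Suc m) s t * D 0 t"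
        using sum_Suc_diff[of 1 m "\<lambda>j. - (u_deriv j s t * D (Suc m - j) t)"] by simp
      finally show ?thesis .
    qed
    have 2: "((\<lambda>t. u_deriv 1 s t * D m t - u_deriv (Suc m) s t * D 0 t) has_integral W2 b - W2 a) {a..b}"
      using ab by (intro fundamental_theorem_of_calculus has_vector_derivative_at_within[OF W2']) auto
    have X: "((\<lambda>t. u_fun s t * Fn t - u_deriv n s t * F t) has_integral W b - W a) {a..b}"
      using has_integral_add[OF 1 2] by (simp add: W u_deriv_0 m D0 algebra_simps)
    have "(\<lambda>t. u_fun s t * Fn t) integrable_on {a..b}"
      by (rule integrable_on_subinterval[OF integrable_on_lebesgue[OF integrable_u_fun_mult[OF tame]]]) auto
    then have "((\<lambda>t. u_fun s t * Fn t) has_integral integral {a..b} (\<lambda>t. u_fun s t * Fn t)) {a..b}"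
      by (rule integrable_integral)
    from has_integral_diff[OF this X] have "((\<lambda>t. u_fun s t * Fn t - (u_fun s t * Fn t - u_deriv n s t * F t)) has_integral
        integral {a..b} (\<lambda>t. u_fun s t * Fn t) - (W b - W a)) {a..b}" .
    then show ?thesis by simp
  qed
  have u: "((\<lambda>t. u_fun s t * Fn t) has_integral Psi Fn s) UNIV"
    unfolding Psi_def by (intro has_integral_integral_lebesgue integrable_u_fun_mult tame)
  have "((\<lambda>t. u_deriv n s t * F t) has_integral Psi Fn s) UNIV"
    unfolding has_integral_alt'
  proof (intro conjI allI impI)
    show "(\<lambda>x. if x \<in> UNIV then u_deriv n s x * F x else 0) integrable_on cbox a b" for a b
      using parts[of a b] by (cases "a \<le> b") (auto simp: integrable_on_def)
    fix e :: real assume e: "e > 0"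
    have "\<forall>e>0. \<exists>B>0. \<forall>a b. ball 0 B \<subseteq> cbox a b \<longrightarrow>
        norm (integral (cbox a b) (\<lambda>t. u_fun s t * Fn t) - Psi Fn s) < e"
      using u unfolding has_integral_alt'[of _ _ UNIV] by simp
    from this[rule_format, of "e / 2"] e
    obtain B1 where B1: "B1 > 0" "\<And>a b. ball 0 B1 \<subseteq> cbox a b \<Longrightarrow> norm (integral (cbox a b) (\<lambda>t. u_fun s t * Fn t) - Psi Fn s) < e / 2"
      by auto
    from W0[unfolded Lim_at_infinity, rule_format, of "e / 4"] e obtain B2 where B2: "\<And>t. B2 \<le> norm t \<Longrightarrow> norm (W t) < e / 4"
      by auto
    \<comment> \<open>A box containing the ball of this radius has both endpoints at modulus at
      least B2, where \<open>W\<close> is below e/4; the boundary terms then cost less than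
      e/2.\<close>
    define B where "B = max B1 (\<bar>B2\<bar> + 1)"
    have "norm (integral (cbox a b) (\<lambda>x. if x \<in> UNIV then u_deriv n s x * F x else 0) - Psi Fn s) < e"
      if sub: "ball 0 B \<subseteq> cbox a b" for a b
    proof -
      have "\<bar>B2\<bar> \<in> ball 0 B" "- \<bar>B2\<bar> \<in> ball 0 B" by (auto simp: B_def)
      then have ab: "\<bar>B2\<bar> \<in> cbox a b" "- \<bar>B2\<bar> \<in> cbox a b" using sub by blast+
      then have le: "a \<le> b" and nab: "B2 \<le> norm a" "B2 \<le> norm b" by auto
      note Wab = B2[OF nab(1)] B2[OF nab(2)]
      have "ball 0 B1 \<subseteq> cbox a b" using sub by (auto simp: B_def)
      note i = B1(2)[OF this]
      have "integral (cbox a b) (\<lambda>x. u_deriv n s x * F x) = integral (cbox a b) (\<lambda>t. u_fun s t * Fn t) - (W b - W a)"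
        using parts[OF le] by (auto intro: integral_unique)
      then have "integral (cbox a b) (\<lambda>x. u_deriv n s x * F x) - Psi Fn s
          = (integral (cbox a b) (\<lambda>t. u_fun s t * Fn t) - Psi Fn s) - (W b - W a)" by simp
      also have "norm \<dots> \<le> norm (integral (cbox a b) (\<lambda>t. u_fun s t * Fn t) - Psi Fn s) + (norm (W b) + norm (W a))"
        by (rule order_trans[OF norm_triangle_ineq4 add_left_mono[OF norm_triangle_ineq4]])
      also have "\<dots> < e" using i Wab by linarith
      finally show ?thesis by simp
    qed
    moreover have "B > 0" using B1 by (simp add: B_def)
    ultimately show "\<exists>B>0. \<forall>a b. ball 0 B \<subseteq> cbox a b \<longrightarrow>
       norm (integral (cbox a b) (\<lambda>x. if x \<in> UNIV then u_deriv n s x * F x else 0) - Psi Fn s) < e" by blast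
  qed
  \<comment> \<open>The explicit kernel and its smooth extension can differ only at the single point
    t = 0.\<close>
  then show ?thesis
    by (rule has_integral_spike_finite[of "{0}", rotated 2]) (simp_all add: u_deriv_eq_kernel)
qed


section \<open>Transformation rules\<close>

lemma Lp_translate: "f \<in> Lp p \<Longrightarrow> translate a f \<in> Lp p"
  using Lp_affine[of f p 1 "-a"] by (simp add: translate_def)

lemma Lp_reflect: "f \<in> Lp p \<Longrightarrow> reflect f \<in> Lp p"
  using Lp_affine[of f p "-1" 0] by (simp add: reflect_def)

lemma Lp_modulate:
  assumes "f \<in> Lp p" "0 \<le> p"
  shows "(\<lambda>t. exp (\<i> * of_real a * of_real t) * f t) \<in> Lp p"
proof (rule Lp_bounded_mult[OF assms])
  show "(\<lambda>t. exp (\<i> * of_real a * of_real t)) \<in> borel_measurable lebesgue"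
    by (intro measurable_completion) measurable
  show "norm (exp (\<i> * of_real a * of_real t)) \<le> 1" for t :: real
    by (simp add: norm_exp_eq_Re)
qed

text \<open>Shifting the variable by a produces u_s(a + t), which is the reflected kernel at -a -
  t.\<close>

lemma Psi_translate: "Psi (translate a f) s = conv f (reflect (u_fun s)) (- a)"
proof -
  have "Psi (translate a f) s = (LINT t|lebesgue. u_fun s (a + 1 * t) * f (a + 1 * t - a))"
    unfolding Psi_def translate_def by (subst lebesgue_integral_real_affine[of 1 _ a]) simp_all
  also have "\<dots> = conv f (reflect (u_fun s)) (- a)"
    by (simp add: conv_def reflect_def mult.commute add.commute)
  finally show ?thesis .
qed

text \<open>The substitution brings |c|, the homogeneity of the kernel brings 1/c, and their product
  is the sign of c; being its own inverse, the sign can change sides.\<close>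

lemma Psi_scale:
  assumes "c \<noteq> 0"
  shows "Psi (\<lambda>x. f (c * x)) s = of_real (sgn c) * Psi f (s / c)"
proof -
  have "Psi f (s / c) = \<bar>c\<bar> *\<^sub>R (LINT t|lebesgue. u_fun (s / c) (0 + c * t) * f (0 + c * t))"
    unfolding Psi_def by (rule lebesgue_integral_real_affine[OF assms])
  also have "\<dots> = of_real \<bar>c\<bar> * (LINT t|lebesgue. of_real (1 / c) * (u_fun s t * f (c * t)))"
  proof -
    have "u_fun (s / c) (c * t) = of_real (1 / c) * u_fun s t" for t
      using u_fun_scale[OF assms, of s "c * t"] assms by (simp add: field_simps)
    then show ?thesis by (simp add: scaleR_conv_of_real mult.assoc)
  qed
  also have "\<dots> = of_real (\<bar>c\<bar> * (1 / c)) * Psi (\<lambda>x. f (c * x)) s"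
    unfolding Psi_def by (subst integral_mult_right_zero) (simp only: of_real_mult mult.assoc)
  also have "\<bar>c\<bar> * (1 / c) = sgn c" using assms by (simp add: sgn_if)
  finally have "of_real (sgn c) * Psi f (s / c) = of_real (sgn c * sgn c) * Psi (\<lambda>x. f (c * x)) s"
    by (simp only: of_real_mult mult.assoc)
  also have "sgn c * sgn c = 1" using assms by (simp add: sgn_if)
  finally show ?thesis by simp
qed

lemma Psi_reflect: "Psi (reflect f) s = - reflect (Psi f) s"
  using Psi_scale[of "-1" f s] by (simp add: reflect_def)

lemma Psi_affine:
  assumes "a \<noteq> 0"
  shows "Psi (\<lambda>x. f (a * x + b)) s = of_real (sgn a) * Psi (translate (- b) f) (s / a)"
  using Psi_scale[OF assms, of "translate (- b) f" s] by (simp add: translate_def)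

lemma Psi_modulate:
  assumes "tame f"
  shows "Psi (\<lambda>t. exp (\<i> * of_real a * of_real t) * f t) s = Psi f (s - a) - Psi f (- a)"
proof -
  have "u_fun s t * (exp (\<i> * of_real a * of_real t) * f t) = u_fun (s - a) t * f t - u_fun (- a) t * f t" for t
  proof -
    have "u_fun s t * (exp (\<i> * of_real a * of_real t) * f t) = (u_fun s t * exp (\<i> * of_real a * of_real t)) * f t"
      by simp
    then show ?thesis unfolding u_fun_mult_exp by (simp only: left_diff_distrib)
  qed
  then show ?thesis
    unfolding Psi_def by (simp only: Bochner_Integration.integral_diff integrable_u_fun_mult[OF assms])
qed

text \<open>The two functions differ by the constant \<open>Psi f (- a)\<close>, which the distributional
  derivative kills.\<close>

lemma fourier_modulate:
  assumes "tame f" "tame (\<lambda>t. exp (\<i> * of_real a * of_real t) * f t)" (is "tame ?F")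
  shows "fourier ?F = dist_deriv (regular_dist (translate a (Psi f)))"
proof (rule fourier_eqI)
  show "dist_deriv (regular_dist (translate a (Psi f))) \<in> extensional Schwartz"
    by (simp add: dist_deriv_def)
  fix \<phi> assume \<phi>: "\<phi> \<in> Schwartz"
  note \<phi>' = Schwartz_vderiv[OF \<phi>]
  note [measurable] = Schwartz_borel[OF \<phi>']
  have i0: "integrable lborel (vderiv \<phi>)"
    using integrable_mult_Schwartz[OF \<phi>', of "\<lambda>_. 1"] by simp
  then have i: "integrable lebesgue (\<lambda>x. Psi f (- a) * vderiv \<phi> x)"
    by (intro integrable_mult_right) (simp add: integrable_completion)
  have 0: "(LINT x|lebesgue. Psi f (- a) * vderiv \<phi> x) = 0"
    using integral_vderiv_Schwartz[OF \<phi>] by (simp add: integral_completion)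
  have "(LINT x|lebesgue. translate a (Psi f) x * vderiv \<phi> x)
      = (LINT x|lebesgue. Psi ?F x * vderiv \<phi> x + Psi f (- a) * vderiv \<phi> x)"
    unfolding translate_def Psi_modulate[OF assms(1)] distrib_right[symmetric] by simp
  also have "\<dots> = (LINT x|lebesgue. Psi ?F x * vderiv \<phi> x)"
    by (simp only: Bochner_Integration.integral_add[OF integrable_Psi_mult(1)[OF assms(2) \<phi>'] i] 0 add_0_right)
  finally show "fourier ?F \<phi> = dist_deriv (regular_dist (translate a (Psi f))) \<phi>"
    using \<phi> \<phi>' by (simp add: fourier_apply dist_deriv_def regular_dist_def)
qed

section \<open>The norm on the image space and the iterated transform\<close>

lemma Ap_norm_fourier:
  assumes "1 \<le> p" "g \<in> Lp p"
  shows "Ap_norm p (fourier g) = Lp_norm p g"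
  unfolding Ap_norm_def
proof (rule the_equality)
  show "\<exists>f\<in>Lp p. fourier f = fourier g \<and> Lp_norm p g = Lp_norm p f" using assms by blast
  fix c assume "\<exists>f\<in>Lp p. fourier f = fourier g \<and> c = Lp_norm p f"
  then obtain f where f: "f \<in> Lp p" "fourier f = fourier g" "c = Lp_norm p f" by blast
  have [measurable]: "f \<in> borel_measurable lebesgue" "g \<in> borel_measurable lebesgue"
    using f assms by (auto simp: Lp_def)
  have "AE x in lebesgue. f x = g x"
    using f assms fourier_inj[of f g] by (auto intro: Lp_imp_tame)
  then have "(LINT x|lebesgue. norm (f x) powr p) = (LINT x|lebesgue. norm (g x) powr p)"
    by (intro integral_cong_AE) auto
  with f show "c = Lp_norm p g" by (simp add: Lp_norm_def)
qed

text \<open>The description is unique although h and a competitor may have different exponents: both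
  lie in the weighted class, where equal regular distributions come from a.e. equal functions, and
  these have equal transforms.\<close>

lemma fourier_dist_regular_dist:
  assumes "1 \<le> r" "h \<in> Lp r"
  shows "fourier_dist (regular_dist h) = fourier h"
  unfolding fourier_dist_def
proof (rule the_equality)
  show "\<exists>r\<ge>1. \<exists>h'\<in>Lp r. regular_dist h = regular_dist h' \<and> fourier h = fourier h'" using assms by blast
  fix U assume "\<exists>r\<ge>1. \<exists>h'\<in>Lp r. regular_dist h = regular_dist h' \<and> U = fourier h'"
  then obtain q h' where h': "1 \<le> q" "h' \<in> Lp q" "regular_dist h = regular_dist h'" "U = fourier h'" by blast
  have "tame h" "tame h'" using assms h' Lp_imp_tame by blast+
  then show "U = fourier h" using fourier_inj[of h h'] regular_dist_inj[of h h'] h' by auto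
qed

section \<open>The eight properties assembled\<close>

theorem theorem4p2:
  fixes p :: real and f :: "real \<Rightarrow> complex"
  assumes p: "1 \<le> p" and f: "f \<in> Lp p"
  shows
    \<comment> \<open>(a)\<close>
    "((\<forall>g\<in>Lp p. fourier g \<in> tempered) \<and>
      (\<forall>g\<in>Lp p. \<forall>h\<in>Lp p. (\<lambda>x. g x + h x) \<in> Lp p \<and>
         fourier (\<lambda>x. g x + h x) = dist_add (fourier g) (fourier h)) \<and>
      (\<forall>c. \<forall>g\<in>Lp p. (\<lambda>x. c * g x) \<in> Lp p \<and>
         fourier (\<lambda>x. c * g x) = dist_scale c (fourier g)) \<and>
      (\<forall>g\<in>Lp p. \<forall>h\<in>Lp p. fourier g = fourier h \<longleftrightarrow> (AE x in lebesgue. g x = h x)) \<and>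
      fourier ` Lp p = Ap p \<and>
      (\<exists>C. \<forall>g\<in>Lp p. Ap_norm p (fourier g) \<le> C * Lp_norm p g) \<and>
      (\<forall>g\<in>Lp p. Ap_norm p (fourier g) = Lp_norm p g))
    \<and> \<comment> \<open>(b)\<close>
     (\<forall>(n::nat) (F :: real \<Rightarrow> complex) (Fn :: real \<Rightarrow> complex).
        n \<ge> 1 \<longrightarrow>
        (\<forall>k<n - 1. \<forall>t. (vderiv ^^ k) F differentiable (at t)) \<longrightarrow>
        abs_cont ((vderiv ^^ (n - 1)) F) \<longrightarrow>
        (AE t in lebesgue. ((vderiv ^^ (n - 1)) F has_vector_derivative Fn t) (at t)) \<longrightarrow>
        Fn \<in> Lp p \<longrightarrow>
        (\<forall>k. k + 2 \<le> n \<longrightarrow> ((\<lambda>t. (vderiv ^^ k) F t / of_real t) \<longlongrightarrow> 0) at_infinity) \<longrightarrow>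
        fourier Fn = dist_deriv (regular_dist (Psi Fn)) \<and>
        (\<forall>s. ((\<lambda>t. u_deriv_kernel n s t * F t) has_integral Psi Fn s) UNIV))
    \<and> \<comment> \<open>(c)\<close>
     (\<forall>n::nat. (dist_deriv ^^ n) (fourier f) = (dist_deriv ^^ (n + 1)) (regular_dist (Psi f)))
    \<and> \<comment> \<open>(d)\<close>
     (\<forall>a::real. translate a f \<in> Lp p \<and>
        fourier (translate a f) = dist_deriv (regular_dist (Psi (translate a f))) \<and>
        (\<forall>s. Psi (translate a f) s = conv f (reflect (u_fun s)) (- a)))
    \<and> \<comment> \<open>(e)\<close>
     (\<forall>a::real. (\<lambda>t. exp (\<i> * of_real a * of_real t) * f t) \<in> Lp p \<and>
        fourier (\<lambda>t. exp (\<i> * of_real a * of_real t) * f t)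
          = dist_deriv (regular_dist (translate a (Psi f))))
    \<and> \<comment> \<open>(f)\<close>
     (reflect f \<in> Lp p \<and>
      fourier (reflect f) = dist_deriv (regular_dist (Psi (reflect f))) \<and>
      (\<forall>s. Psi (reflect f) s = - reflect (Psi f) s))
    \<and> \<comment> \<open>(g)\<close>
     (\<forall>r\<ge>1. \<forall>h\<in>Lp r. fourier f = regular_dist h \<longrightarrow>
        fourier_dist (fourier f) = dist_deriv (regular_dist (Psi h)))
    \<and> \<comment> \<open>(h)\<close>
     (\<forall>a b::real. a \<noteq> 0 \<longrightarrow>
        (\<lambda>x. f (a * x + b)) \<in> Lp p \<and>
        fourier (\<lambda>x. f (a * x + b)) = dist_deriv (regular_dist (Psi (\<lambda>x. f (a * x + b)))) \<and>
        (\<forall>s. Psi (\<lambda>x. f (a * x + b)) s = of_real (sgn a) * Psi (translate (- b) f) (s / a)))"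
proof -
  have tame: "tame g" if "g \<in> Lp p" for g using Lp_imp_tame[OF p that] .
  have a: "(\<forall>g\<in>Lp p. fourier g \<in> tempered) \<and>
      (\<forall>g\<in>Lp p. \<forall>h\<in>Lp p. (\<lambda>x. g x + h x) \<in> Lp p \<and>
         fourier (\<lambda>x. g x + h x) = dist_add (fourier g) (fourier h)) \<and>
      (\<forall>c. \<forall>g\<in>Lp p. (\<lambda>x. c * g x) \<in> Lp p \<and>
         fourier (\<lambda>x. c * g x) = dist_scale c (fourier g)) \<and>
      (\<forall>g\<in>Lp p. \<forall>h\<in>Lp p. fourier g = fourier h \<longleftrightarrow> (AE x in lebesgue. g x = h x)) \<and>
      fourier ` Lp p = Ap p \<and>
      (\<exists>C. \<forall>g\<in>Lp p. Ap_norm p (fourier g) \<le> C * Lp_norm p g) \<and>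
      (\<forall>g\<in>Lp p. Ap_norm p (fourier g) = Lp_norm p g)"
  proof (intro conjI ballI allI)
    show "\<exists>C. \<forall>g\<in>Lp p. Ap_norm p (fourier g) \<le> C * Lp_norm p g"
      by (intro exI[of _ 1]) (simp add: Ap_norm_fourier[OF p])
    show "(\<lambda>x. c * g x) \<in> Lp p" if "g \<in> Lp p" for c g
      using p by (intro Lp_bounded_mult[OF that, of _ "norm c"]) auto
  qed (use p tame in \<open>simp_all add: fourier_tempered Lp_add fourier_add fourier_cmult fourier_inj
        Ap_def Ap_norm_fourier\<close>)
  have b: "\<forall>(n::nat) (F :: real \<Rightarrow> complex) (Fn :: real \<Rightarrow> complex).
        n \<ge> 1 \<longrightarrow>
        (\<forall>k<n - 1. \<forall>t. (vderiv ^^ k) F differentiable (at t)) \<longrightarrow>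
        abs_cont ((vderiv ^^ (n - 1)) F) \<longrightarrow>
        (AE t in lebesgue. ((vderiv ^^ (n - 1)) F has_vector_derivative Fn t) (at t)) \<longrightarrow>
        Fn \<in> Lp p \<longrightarrow>
        (\<forall>k. k + 2 \<le> n \<longrightarrow> ((\<lambda>t. (vderiv ^^ k) F t / of_real t) \<longlongrightarrow> 0) at_infinity) \<longrightarrow>
        fourier Fn = dist_deriv (regular_dist (Psi Fn)) \<and>
        (\<forall>s. ((\<lambda>t. u_deriv_kernel n s t * F t) has_integral Psi Fn s) UNIV)"
    by (intro allI impI conjI fourier_def has_integral_u_deriv_kernel) (simp_all add: tame)
  \<comment> \<open>Both sides differentiate the same regular distribution n + 1 times; only the
    order of iteration differs.\<close>
  have c: "\<forall>n::nat. (dist_deriv ^^ n) (fourier f) = (dist_deriv ^^ (n + 1)) (regular_dist (Psi f))"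
    by (simp add: fourier_def funpow_swap1)
  have d: "\<forall>a::real. translate a f \<in> Lp p \<and>
        fourier (translate a f) = dist_deriv (regular_dist (Psi (translate a f))) \<and>
        (\<forall>s. Psi (translate a f) s = conv f (reflect (u_fun s)) (- a))"
    using Lp_translate[OF f] Psi_translate by (simp add: fourier_def)
  have m: "(\<lambda>t. exp (\<i> * of_real a * of_real t) * f t) \<in> Lp p" for a
    using p by (intro Lp_modulate[OF f]) simp
  have e: "\<forall>a::real. (\<lambda>t. exp (\<i> * of_real a * of_real t) * f t) \<in> Lp p \<and>
        fourier (\<lambda>t. exp (\<i> * of_real a * of_real t) * f t)
          = dist_deriv (regular_dist (translate a (Psi f)))"
    by (intro allI conjI m fourier_modulate tame f)
  have r: "reflect f \<in> Lp p \<and>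
      fourier (reflect f) = dist_deriv (regular_dist (Psi (reflect f))) \<and>
      (\<forall>s. Psi (reflect f) s = - reflect (Psi f) s)"
    using Lp_reflect[OF f] Psi_reflect by (simp add: fourier_def)
  have g: "\<forall>r\<ge>1. \<forall>h\<in>Lp r. fourier f = regular_dist h \<longrightarrow>
        fourier_dist (fourier f) = dist_deriv (regular_dist (Psi h))"
    by (simp add: fourier_dist_regular_dist fourier_def[symmetric])
  have h: "\<forall>a b::real. a \<noteq> 0 \<longrightarrow>
        (\<lambda>x. f (a * x + b)) \<in> Lp p \<and>
        fourier (\<lambda>x. f (a * x + b)) = dist_deriv (regular_dist (Psi (\<lambda>x. f (a * x + b)))) \<and>
        (\<forall>s. Psi (\<lambda>x. f (a * x + b)) s = of_real (sgn a) * Psi (translate (- b) f) (s / a))"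
  proof (intro allI impI conjI fourier_def Psi_affine)
    fix a b :: real assume "a \<noteq> 0"
    then show "(\<lambda>x. f (a * x + b)) \<in> Lp p"
      using Lp_affine[OF f, of a b] by (simp add: add.commute)
  qed
  show ?thesis
    by (rule conjI[OF a conjI[OF b conjI[OF c conjI[OF d conjI[OF e conjI[OF r conjI[OF g h]]]]]]])
qed

end
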